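(* Let $(M,[\nabla])$ be an $n$-dimensional manifold with a projective structure, with projective Weyl tensor $W^a_{~bcd}$. A necessary condition for $[\nabla]$ to include a connection $\hat\nabla$ which is the Levi-Civita connection of some (pseudo-Riemannian) metric $\hat g_{ab}$ is the existence of a symmetric nondegenerate bilinear form $g^{ab}$ on $M$ such that $$g_{ae}\,g^{bc}\,W^e_{~bcd}=g_{de}\,g^{bc}\,W^e_{~bca},\qquad ( * )$$ where $g_{ab}$ is the inverse of $g^{ab}$, $g_{ac}g^{cb}=\delta^b_{~a}$. Moreover, if a Levi-Civita connection $\hat\nabla$ from the projective class $[\nabla]$ exists, then its corresponding metric $\hat g_{ab}$ must be conformal to the inverse $g_{ab}$ of some solution $g^{ab}$ of $( * )$, i.e. $\hat g_{ab}=e^{2\phi}g_{ab}$ for a solution $g^{ab}$ of $( * )$ and some function $\phi$ on $M$.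
   Context: A projective structure $[\nabla]$ on an $n$-dimensional manifold $M$ ($n\ge2$) is an equivalence class of torsion-free affine connections, where $\hat\nabla\sim\nabla$ iff there is a 1-form $A$ with $\hat\nabla_XY=\nabla_XY+A(X)Y+A(Y)X$ for all vector fields $X,Y$. For a representative $\nabla$ with connection 1-forms $\Gamma^a_{~b}=\Gamma^a_{~bc}\theta^c$ in a coframe $(\theta^a)$ dual to $(X_a)$ ($\nabla_{X_a}X_b=\Gamma^c_{~ba}X_c$), put $\Omega^a_{~b}=d\Gamma^a_{~b}+\Gamma^a_{~c}\wedge\Gamma^c_{~b}=\frac12R^a_{~bcd}\theta^c\wedge\theta^d$, $R_{ab}=R^c_{~acb}$, $\mathsf P_{ab}=\frac1{n-1}R_{(ab)}-\frac1{n+1}R_{[ab]}$ (brackets denote (anti)symmetrization with factor $\frac12$). The projective Weyl tensor is $$W^a_{~bcd}=R^a_{~bcd}-\delta^a_{~c}\mathsf P_{db}+\delta^a_{~d}\mathsf P_{cb}+2\delta^a_{~b}\mathsf P_{[cd]};$$ it is the same for all connections in $[\nabla]$. *)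

theory Defs
  imports "HOL-Analysis.Analysis"
begin

section \<open>Smooth maps between Euclidean spaces\<close>

text \<open>These two notions are meant for open sets \<open>S\<close>.\<close>

fun Ck_on :: "nat \<Rightarrow> 'a::real_normed_vector set \<Rightarrow> ('a \<Rightarrow> 'b::real_normed_vector) \<Rightarrow> bool"
  where
    "Ck_on 0 S f \<longleftrightarrow> continuous_on S f"
  | "Ck_on (Suc k) S f \<longleftrightarrow>
       (\<forall>x\<in>S. f differentiable (at x)) \<and>
       (\<forall>v. Ck_on k S (\<lambda>x. frechet_derivative f (at x) v))"

definition smooth_on :: "'a::real_normed_vector set \<Rightarrow> ('a \<Rightarrow> 'b::real_normed_vector) \<Rightarrow> bool"
  where "smooth_on S f \<longleftrightarrow> (\<forall>k. Ck_on k S f)"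


section \<open>Smooth manifolds\<close>

text \<open>A chart is a pair of its domain and its coordinate map; the dimension of the manifold is
  \<open>CARD('n)\<close>.\<close>

type_synonym ('m, 'n) chart = "'m set \<times> ('m \<Rightarrow> real ^ 'n)"

definition chart_inv :: "('m, 'n::finite) chart \<Rightarrow> real ^ 'n \<Rightarrow> 'm"
  where "chart_inv c = inv_into (fst c) (snd c)"

definition is_chart :: "'m topology \<Rightarrow> ('m, 'n::finite) chart \<Rightarrow> bool"
  where "is_chart M c \<longleftrightarrow>
    openin M (fst c) \<and> open (snd c ` fst c) \<and>
    homeomorphic_map (subtopology M (fst c)) (top_of_set (snd c ` fst c)) (snd c)"

definition transition :: "('m, 'n::finite) chart \<Rightarrow> ('m, 'n) chart \<Rightarrow> real ^ 'n \<Rightarrow> real ^ 'n"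
  where "transition c c' = (\<lambda>x. snd c' (chart_inv c x))"

definition smooth_atlas :: "'m topology \<Rightarrow> ('m, 'n::finite) chart set \<Rightarrow> bool"
  where "smooth_atlas M \<A> \<longleftrightarrow>
    (\<forall>c\<in>\<A>. is_chart M c) \<and> (\<Union>c\<in>\<A>. fst c) = topspace M \<and>
    (\<forall>c\<in>\<A>. \<forall>c'\<in>\<A>. smooth_on (snd c ` (fst c \<inter> fst c')) (transition c c'))"

definition smooth_manifold :: "'m topology \<Rightarrow> ('m, 'n::finite) chart set \<Rightarrow> bool"
  where "smooth_manifold M \<A> \<longleftrightarrow>
    Hausdorff_space M \<and> second_countable M \<and> smooth_atlas M \<A>"


section \<open>Tensor fields\<close>

text \<open>A tensor field on an open set \<open>U\<close> is given by its components with respect to the coordinate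
  frame of each chart of the atlas, subject to the tensorial transformation law.  The value
  \<open>F c p\<close> of such a family is meaningful only for \<open>c \<in> \<A>\<close> and \<open>p \<in> U \<inter> fst c\<close>.
  The entry in row \<open>i\<close> and column \<open>j\<close> of \<open>jac c c' p\<close> is the partial
  derivative of the \<open>i\<close>-th coordinate of \<open>c'\<close> along the \<open>j\<close>-th coordinate
  of \<open>c\<close>, at \<open>p\<close>.\<close>

definition jac :: "('m, 'n::finite) chart \<Rightarrow> ('m, 'n) chart \<Rightarrow> 'm \<Rightarrow> real ^ 'n ^ 'n"
  where "jac c c' p = jacobian (transition c c') (at (snd c p))"

definition smooth_family ::
    "('m, 'n::finite) chart set \<Rightarrow> 'm set \<Rightarrow> (('m, 'n) chart \<Rightarrow> 'm \<Rightarrow> 'b::real_normed_vector) \<Rightarrow> bool"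
  where "smooth_family \<A> U F \<longleftrightarrow>
    (\<forall>c\<in>\<A>. smooth_on (snd c ` (U \<inter> fst c)) (\<lambda>x. F c (chart_inv c x)))"

definition smooth_function :: "('m, 'n::finite) chart set \<Rightarrow> 'm set \<Rightarrow> ('m \<Rightarrow> real) \<Rightarrow> bool"
  where "smooth_function \<A> U f \<longleftrightarrow> smooth_family \<A> U (\<lambda>c. f)"

type_synonym ('m, 'n) vec_field = "('m, 'n) chart \<Rightarrow> 'm \<Rightarrow> real ^ 'n"
type_synonym ('m, 'n) form_field = "('m, 'n) chart \<Rightarrow> 'm \<Rightarrow> real ^ 'n"
type_synonym ('m, 'n) bilin_field = "('m, 'n) chart \<Rightarrow> 'm \<Rightarrow> real ^ 'n ^ 'n"

definition vector_field :: "('m, 'n::finite) chart set \<Rightarrow> 'm set \<Rightarrow> ('m, 'n) vec_field \<Rightarrow> bool"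
  where "vector_field \<A> U X \<longleftrightarrow> smooth_family \<A> U X \<and>
    (\<forall>c\<in>\<A>. \<forall>c'\<in>\<A>. \<forall>p \<in> U \<inter> fst c \<inter> fst c'. X c' p = jac c c' p *v X c p)"

definition one_form :: "('m, 'n::finite) chart set \<Rightarrow> 'm set \<Rightarrow> ('m, 'n) form_field \<Rightarrow> bool"
  where "one_form \<A> U A \<longleftrightarrow> smooth_family \<A> U A \<and>
    (\<forall>c\<in>\<A>. \<forall>c'\<in>\<A>. \<forall>p \<in> U \<inter> fst c \<inter> fst c'. A c p = transpose (jac c c' p) *v A c' p)"

text \<open>Symmetric nondegenerate bilinear forms with upper indices, and with lower indices.  No
  condition on the signature is imposed.\<close>

definition nondegenerate_upper_form ::
    "'m topology \<Rightarrow> ('m, 'n::finite) chart set \<Rightarrow> ('m, 'n) bilin_field \<Rightarrow> bool"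
  where "nondegenerate_upper_form M \<A> G \<longleftrightarrow> smooth_family \<A> (topspace M) G \<and>
    (\<forall>c\<in>\<A>. \<forall>p \<in> fst c. transpose (G c p) = G c p \<and> invertible (G c p)) \<and>
    (\<forall>c\<in>\<A>. \<forall>c'\<in>\<A>. \<forall>p \<in> fst c \<inter> fst c'.
       G c' p = jac c c' p ** G c p ** transpose (jac c c' p))"

definition pseudo_riemannian_metric ::
    "'m topology \<Rightarrow> ('m, 'n::finite) chart set \<Rightarrow> ('m, 'n) bilin_field \<Rightarrow> bool"
  where "pseudo_riemannian_metric M \<A> h \<longleftrightarrow> smooth_family \<A> (topspace M) h \<and>
    (\<forall>c\<in>\<A>. \<forall>p \<in> fst c. transpose (h c p) = h c p \<and> invertible (h c p)) \<and>
    (\<forall>c\<in>\<A>. \<forall>c'\<in>\<A>. \<forall>p \<in> fst c \<inter> fst c'.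
       h c p = transpose (jac c c' p) ** h c' p ** jac c c' p)"

definition eq_field ::
    "('m, 'n::finite) chart set \<Rightarrow> 'm set \<Rightarrow> ('m, 'n) vec_field \<Rightarrow> ('m, 'n) vec_field \<Rightarrow> bool"
  where "eq_field \<A> U X Y \<longleftrightarrow> (\<forall>c\<in>\<A>. \<forall>p \<in> U \<inter> fst c. X c p = Y c p)"

text \<open>\<open>X(f)\<close> at \<open>p\<close>, computed in the chart \<open>c\<close>; also used
  componentwise for vector-valued \<open>f\<close>.\<close>

definition dir_deriv ::
    "('m, 'n::finite) chart \<Rightarrow> ('m, 'n) vec_field \<Rightarrow> ('m \<Rightarrow> 'b::real_normed_vector) \<Rightarrow> 'm \<Rightarrow> 'b"
  where "dir_deriv c X f p =
    frechet_derivative (\<lambda>x. f (chart_inv c x)) (at (snd c p)) (X c p)"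

definition lie_bracket ::
    "('m, 'n::finite) vec_field \<Rightarrow> ('m, 'n) vec_field \<Rightarrow> ('m, 'n) vec_field"
  where "lie_bracket X Y = (\<lambda>c p. dir_deriv c X (Y c) p - dir_deriv c Y (X c) p)"

text \<open>The \<open>a\<close>-th coordinate vector field of the chart \<open>c\<close>, on the domain of
  \<open>c\<close>.\<close>

definition coord_field :: "('m, 'n::finite) chart \<Rightarrow> 'n \<Rightarrow> ('m, 'n) vec_field"
  where "coord_field c a = (\<lambda>c' p. jac c c' p *v axis a 1)"


section \<open>Affine connections and projective structures\<close>

text \<open>\<open>D U X Y\<close> is the covariant derivative of \<open>Y\<close> along \<open>X\<close> for vector
  fields on the open set \<open>U\<close>.  Vector fields on arbitrary open subsets are admitted in order
  to have coordinate frames at hand; the first condition below is compatibility with restriction.\<close>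

type_synonym ('m, 'n) connection =
  "'m set \<Rightarrow> ('m, 'n) vec_field \<Rightarrow> ('m, 'n) vec_field \<Rightarrow> ('m, 'n) vec_field"

definition affine_connection ::
    "'m topology \<Rightarrow> ('m, 'n::finite) chart set \<Rightarrow> ('m, 'n) connection \<Rightarrow> bool"
  where "affine_connection M \<A> D \<longleftrightarrow>
    (\<forall>U V X Y X' Y'. openin M U \<and> openin M V \<and> V \<subseteq> U \<and>
       vector_field \<A> U X \<and> vector_field \<A> U Y \<and> vector_field \<A> V X' \<and> vector_field \<A> V Y' \<and>
       eq_field \<A> V X X' \<and> eq_field \<A> V Y Y' \<longrightarrow> eq_field \<A> V (D U X Y) (D V X' Y')) \<and>
    (\<forall>U X Y. openin M U \<and> vector_field \<A> U X \<and> vector_field \<A> U Y \<longrightarrow>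
       vector_field \<A> U (D U X Y)) \<and>
    (\<forall>U X Y Z. openin M U \<and> vector_field \<A> U X \<and> vector_field \<A> U Y \<and> vector_field \<A> U Z \<longrightarrow>
       eq_field \<A> U (D U (\<lambda>c p. X c p + Y c p) Z) (\<lambda>c p. D U X Z c p + D U Y Z c p) \<and>
       eq_field \<A> U (D U X (\<lambda>c p. Y c p + Z c p)) (\<lambda>c p. D U X Y c p + D U X Z c p)) \<and>
    (\<forall>U f X Y. openin M U \<and> smooth_function \<A> U f \<and> vector_field \<A> U X \<and> vector_field \<A> U Y \<longrightarrow>
       eq_field \<A> U (D U (\<lambda>c p. f p *\<^sub>R X c p) Y) (\<lambda>c p. f p *\<^sub>R D U X Y c p) \<and>
       eq_field \<A> U (D U X (\<lambda>c p. f p *\<^sub>R Y c p))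
         (\<lambda>c p. dir_deriv c X f p *\<^sub>R Y c p + f p *\<^sub>R D U X Y c p))"

definition torsion_free_connection ::
    "'m topology \<Rightarrow> ('m, 'n::finite) chart set \<Rightarrow> ('m, 'n) connection \<Rightarrow> bool"
  where "torsion_free_connection M \<A> D \<longleftrightarrow> affine_connection M \<A> D \<and>
    (\<forall>U X Y. openin M U \<and> vector_field \<A> U X \<and> vector_field \<A> U Y \<longrightarrow>
       eq_field \<A> U (\<lambda>c p. D U X Y c p - D U Y X c p) (lie_bracket X Y))"

definition projectively_equivalent ::
    "'m topology \<Rightarrow> ('m, 'n::finite) chart set \<Rightarrow> ('m, 'n) connection \<Rightarrow> ('m, 'n) connection \<Rightarrow> bool"
  where "projectively_equivalent M \<A> D D' \<longleftrightarrow>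
    (\<exists>A. one_form \<A> (topspace M) A \<and>
      (\<forall>U X Y. openin M U \<and> vector_field \<A> U X \<and> vector_field \<A> U Y \<longrightarrow>
         eq_field \<A> U (D' U X Y)
           (\<lambda>c p. D U X Y c p + (A c p \<bullet> X c p) *\<^sub>R Y c p + (A c p \<bullet> Y c p) *\<^sub>R X c p)))"

definition projective_structure ::
    "'m topology \<Rightarrow> ('m, 'n::finite) chart set \<Rightarrow> ('m, 'n) connection set \<Rightarrow> bool"
  where "projective_structure M \<A> \<P> \<longleftrightarrow>
    \<P> \<in> Collect (torsion_free_connection M \<A>) //
      {(D, D'). torsion_free_connection M \<A> D \<and> torsion_free_connection M \<A> D' \<and>
                projectively_equivalent M \<A> D D'}"

definition levi_civita_connection ::
    "'m topology \<Rightarrow> ('m, 'n::finite) chart set \<Rightarrow> ('m, 'n) bilin_field \<Rightarrow> ('m, 'n) connection \<Rightarrow> bool"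
  where "levi_civita_connection M \<A> h D \<longleftrightarrow> torsion_free_connection M \<A> D \<and>
    (\<forall>U X Y Z. openin M U \<and> vector_field \<A> U X \<and> vector_field \<A> U Y \<and> vector_field \<A> U Z \<longrightarrow>
       (\<forall>c\<in>\<A>. \<forall>p \<in> U \<inter> fst c.
          dir_deriv c X (\<lambda>q. Y c q \<bullet> (h c q *v Z c q)) p =
            D U X Y c p \<bullet> (h c p *v Z c p) + Y c p \<bullet> (h c p *v D U X Z c p)))"


section \<open>Curvature and the projective Weyl tensor\<close>

text \<open>Components at \<open>p\<close> with respect to the coordinate frame of the chart \<open>c\<close>;
  indices are listed in the order in which they appear in \<open>\<Gamma>\<^sup>a\<^sub>b\<^sub>c\<close>,
  \<open>R\<^sup>a\<^sub>b\<^sub>c\<^sub>d\<close>, \<open>W\<^sup>a\<^sub>b\<^sub>c\<^sub>d\<close>.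
  The last lower index of \<open>\<Gamma>\<close> is the direction of differentiation.\<close>

definition christoffel ::
    "('m, 'n::finite) connection \<Rightarrow> ('m, 'n) chart \<Rightarrow> 'm \<Rightarrow> 'n \<Rightarrow> 'n \<Rightarrow> 'n \<Rightarrow> real"
  where "christoffel D c p a b d = D (fst c) (coord_field c d) (coord_field c b) c p $ a"

definition partial_deriv :: "('m, 'n::finite) chart \<Rightarrow> 'n \<Rightarrow> ('m \<Rightarrow> real) \<Rightarrow> 'm \<Rightarrow> real"
  where "partial_deriv c k f p =
    frechet_derivative (\<lambda>x. f (chart_inv c x)) (at (snd c p)) (axis k 1)"

text \<open>With \<open>\<theta>\<^sup>a = dx\<^sup>a\<close> and
  \<open>\<Gamma>\<^sup>a\<^sub>b = \<Gamma>\<^sup>a\<^sub>b\<^sub>d \<theta>\<^sup>d\<close>, these are the components of the 2-form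
  \<open>d\<Gamma>\<^sup>a\<^sub>b + \<Gamma>\<^sup>a\<^sub>e \<and> \<Gamma>\<^sup>e\<^sub>b = (1/2) R\<^sup>a\<^sub>b\<^sub>c\<^sub>d \<theta>\<^sup>c \<and> \<theta>\<^sup>d\<close>.\<close>

definition curvature ::
    "('m, 'n::finite) connection \<Rightarrow> ('m, 'n) chart \<Rightarrow> 'm \<Rightarrow> 'n \<Rightarrow> 'n \<Rightarrow> 'n \<Rightarrow> 'n \<Rightarrow> real"
  where "curvature D c p a b k d =
    partial_deriv c k (\<lambda>q. christoffel D c q a b d) p
    - partial_deriv c d (\<lambda>q. christoffel D c q a b k) p
    + (\<Sum>e\<in>UNIV. christoffel D c p a e k * christoffel D c p e b d
                 - christoffel D c p a e d * christoffel D c p e b k)"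

definition ricci :: "('m, 'n::finite) connection \<Rightarrow> ('m, 'n) chart \<Rightarrow> 'm \<Rightarrow> 'n \<Rightarrow> 'n \<Rightarrow> real"
  where "ricci D c p a b = (\<Sum>k\<in>UNIV. curvature D c p k a k b)"

definition schouten :: "('m, 'n::finite) connection \<Rightarrow> ('m, 'n) chart \<Rightarrow> 'm \<Rightarrow> 'n \<Rightarrow> 'n \<Rightarrow> real"
  where "schouten D c p a b =
    1 / (real CARD('n) - 1) * ((ricci D c p a b + ricci D c p b a) / 2)
    - 1 / (real CARD('n) + 1) * ((ricci D c p a b - ricci D c p b a) / 2)"

definition kronecker :: "'n \<Rightarrow> 'n \<Rightarrow> real"
  where "kronecker a b = (if a = b then 1 else 0)"

definition projective_weyl ::
    "('m, 'n::finite) connection \<Rightarrow> ('m, 'n) chart \<Rightarrow> 'm \<Rightarrow> 'n \<Rightarrow> 'n \<Rightarrow> 'n \<Rightarrow> 'n \<Rightarrow> real"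
  where "projective_weyl D c p a b k d =
    curvature D c p a b k d
    - kronecker a k * schouten D c p d b
    + kronecker a d * schouten D c p k b
    + 2 * kronecker a b * ((schouten D c p k d - schouten D c p d k) / 2)"

text \<open>The algebraic condition on \<open>g\<^sup>a\<^sup>b\<close>, here \<open>G\<close>, where
  \<open>g\<^sub>a\<^sub>b\<close> is the inverse matrix.\<close>

definition weyl_condition ::
    "('m, 'n::finite) chart set \<Rightarrow> ('m, 'n) connection \<Rightarrow> ('m, 'n) bilin_field \<Rightarrow> bool"
  where "weyl_condition \<A> D G \<longleftrightarrow>
    (\<forall>c\<in>\<A>. \<forall>p \<in> fst c. \<forall>a d.
      (\<Sum>e\<in>UNIV. \<Sum>b\<in>UNIV. \<Sum>k\<in>UNIV.
         matrix_inv (G c p) $ a $ e * G c p $ b $ k * projective_weyl D c p e b k d) =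
      (\<Sum>e\<in>UNIV. \<Sum>b\<in>UNIV. \<Sum>k\<in>UNIV.
         matrix_inv (G c p) $ d $ e * G c p $ b $ k * projective_weyl D c p e b k a))"

end

theory Submission
  imports Defs
begin

text \<open>The Weyl tensor depends only on the projective class, so it may be computed from the Levi-Civita
  connection of the metric \<open>h\<close> in question.  There \<open>R\<^sub>a\<^sub>b\<^sub>c\<^sub>d\<close> is skew in \<open>a, b\<close>, whence the first
  Bianchi identity makes the Ricci tensor symmetric and the Schouten tensor \<open>P\<close> is symmetric too.
  Contracting \<open>W\<close> with \<open>g = h\<^sup>-\<^sup>1\<close> turns the curvature term into \<open>- R\<^sub>a\<^sub>d\<close> and the remaining terms into
  \<open>- P\<^sub>a\<^sub>d\<close> and a multiple of \<open>h\<^sub>a\<^sub>d\<close>, all symmetric in \<open>a, d\<close>.  So \<open>g = h\<^sup>-\<^sup>1\<close> itself solves the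
  equation, with conformal factor \<open>\<phi> = 0\<close>.\<close>

section \<open>Calculus of \<open>C\<^sup>k\<close> maps\<close>

text \<open>The equation is unchanged when \<open>G\<close> is multiplied by a nowhere vanishing
  function, because \<open>G\<close> and its inverse enter once each. It therefore sees only the
  conformal class, and the factor in the conclusion is the freedom to choose a representative. The
  obstacle is the gap between the two levels of the definitions: a connection is an operator on
  vector fields over open sets, while curvature is made of derivatives of Christoffel symbols in a
  chart. Every geometric hypothesis is therefore tested on coordinate fields, which must first be
  shown to be smooth in all charts. Two analytic facts carry the rest: second partial derivatives of
  \<open>h\<close> commute, which is the source of the skewness of the curvature, and the inverse
  matrix of \<open>h\<close> is smooth. Both are derived for the recursive notion
  \<open>Ck_on\<close>.\<close>

lemma frechet_derivative_eqI:
  "(f has_derivative f') (at x) \<Longrightarrow> frechet_derivative f (at x) = f'"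
  by (rule frechet_derivative_at[symmetric])

text \<open>A Frechet derivative depends only on the germ of the map, so on an open set agreement
  passes to derivatives of every order. This matters because \<open>chart_inv\<close> has its
  meaning only on the image of the chart.\<close>

lemma Ck_on_cong:
  assumes "open S" "\<And>x. x \<in> S \<Longrightarrow> f x = g x" "Ck_on k S f"
  shows "Ck_on k S g"
  using assms(2,3)
proof (induction k arbitrary: f g)
  case 0
  then show ?case by (simp cong: continuous_on_cong)
next
  case (Suc k)
  have d: "(g has_derivative frechet_derivative f (at x)) (at x)" if "x \<in> S" for x
  proof -
    have "(f has_derivative frechet_derivative f (at x)) (at x)"
      using Suc.prems(2) that by (simp flip: frechet_derivative_works)
    then show ?thesis
      using has_derivative_transform_within_open assms(1) that Suc.prems(1) by blast
  qed
  have eq: "frechet_derivative f (at x) = frechet_derivative g (at x)" if "x \<in> S" for x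
    using frechet_derivative_at[OF d[OF that]] .
  have "Ck_on k S (\<lambda>x. frechet_derivative g (at x) v)" for v
    by (rule Suc.IH[of "\<lambda>x. frechet_derivative f (at x) v"]) (use eq Suc.prems(2) in auto)
  then show ?case
    using d by (auto simp: differentiable_def)
qed

lemma Ck_on_SucD: "Ck_on (Suc k) S f \<Longrightarrow> Ck_on k S f"
proof (induction k arbitrary: f)
  case 0
  then show ?case
    by (auto intro!: differentiable_imp_continuous_on differentiable_at_imp_differentiable_on)
next
  case (Suc k)
  have "f differentiable (at x)" if "x \<in> S" for x
    using Suc.prems that by simp
  moreover have "Ck_on k S (\<lambda>x. frechet_derivative f (at x) v)" for v
    using Suc.prems by (intro Suc.IH) (simp only: Ck_on.simps(2)[of "Suc k"])
  ultimately show ?case by simp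
qed

lemma Ck_on_derivative:
  "Ck_on (Suc k) S f \<Longrightarrow> x \<in> S \<Longrightarrow> (f has_derivative frechet_derivative f (at x)) (at x)"
  by (simp flip: frechet_derivative_works)

text \<open>Reduces each closure property below to a derivative formula and an induction hypothesis,
  with no explicit \<open>frechet_derivative\<close> of the composite map.\<close>

lemma Ck_on_SucI:
  assumes "open S" "\<And>x. x \<in> S \<Longrightarrow> (f has_derivative f' x) (at x)"
    and "\<And>v. Ck_on k S (\<lambda>x. f' x v)"
  shows "Ck_on (Suc k) S f"
proof -
  have "Ck_on k S (\<lambda>x. frechet_derivative f (at x) v)" for v
    by (rule Ck_on_cong[OF assms(1) _ assms(3)[of v]])
      (simp add: frechet_derivative_eqI[OF assms(2)])
  then show ?thesis
    using assms(2) by (auto simp: differentiable_def)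
qed

lemma Ck_on_const: "Ck_on k S (\<lambda>x. c)"
  by (induction k arbitrary: c) auto

lemma Ck_on_bounded_linear:
  assumes "open S" "bounded_linear L" "Ck_on k S f"
  shows "Ck_on k S (\<lambda>x. L (f x))"
  using assms(3)
proof (induction k arbitrary: f)
  case 0
  then show ?case
    using bounded_linear.continuous_on[OF assms(2)] by simp
next
  case (Suc k)
  show ?case
  proof (rule Ck_on_SucI[OF assms(1)])
    show "((\<lambda>x. L (f x)) has_derivative (\<lambda>v. L (frechet_derivative f (at x) v))) (at x)"
      if "x \<in> S" for x
      by (rule bounded_linear.has_derivative[OF assms(2) Ck_on_derivative[OF Suc.prems that]])
    show "Ck_on k S (\<lambda>x. L (frechet_derivative f (at x) v))" for v
      using Suc by simp
  qed
qed

lemma Ck_on_add: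
  assumes "open S" "Ck_on k S f" "Ck_on k S g"
  shows "Ck_on k S (\<lambda>x. f x + g x)"
  using assms(2,3)
proof (induction k arbitrary: f g)
  case 0
  then show ?case by (simp add: continuous_on_add)
next
  case (Suc k)
  show ?case
  proof (rule Ck_on_SucI[OF assms(1)])
    show "((\<lambda>x. f x + g x) has_derivative
        (\<lambda>v. frechet_derivative f (at x) v + frechet_derivative g (at x) v)) (at x)"
      if "x \<in> S" for x
      using that Suc.prems by (intro has_derivative_add Ck_on_derivative)
    show "Ck_on k S (\<lambda>x. frechet_derivative f (at x) v + frechet_derivative g (at x) v)" for v
      using Suc by simp
  qed
qed

lemma Ck_on_sum:
  assumes "open S" "\<And>i. i \<in> I \<Longrightarrow> Ck_on k S (f i)"
  shows "Ck_on k S (\<lambda>x. \<Sum>i\<in>I. f i x)"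
  using assms(2)
proof (induction I rule: infinite_finite_induct)
  case (insert i I)
  then show ?case
    using Ck_on_add[OF assms(1), of k "f i"] by simp
qed (simp_all add: Ck_on_const)

lemma Ck_on_bounded_bilinear:
  assumes "open S" "bounded_bilinear B" "Ck_on k S f" "Ck_on k S g"
  shows "Ck_on k S (\<lambda>x. B (f x) (g x))"
  using assms(3,4)
proof (induction k arbitrary: f g)
  case 0
  then show ?case
    using bounded_bilinear.continuous_on[OF assms(2)] by simp
next
  case (Suc k)
  show ?case
  proof (rule Ck_on_SucI[OF assms(1)])
    show "((\<lambda>x. B (f x) (g x)) has_derivative
        (\<lambda>v. B (f x) (frechet_derivative g (at x) v) + B (frechet_derivative f (at x) v) (g x))) (at x)"
      if "x \<in> S" for x
      using that Suc.prems by (intro bounded_bilinear.FDERIV[OF assms(2)] Ck_on_derivative)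
    show "Ck_on k S (\<lambda>x. B (f x) (frechet_derivative g (at x) v) + B (frechet_derivative f (at x) v) (g x))"
      for v
      using Suc.prems by (intro Ck_on_add assms(1) Suc.IH Ck_on_SucD[of k S f] Ck_on_SucD[of k S g]) auto
  qed
qed

lemma Ck_on_prod:
  fixes f :: "'i \<Rightarrow> 'a::real_normed_vector \<Rightarrow> real"
  assumes "open S" "\<And>i. i \<in> I \<Longrightarrow> Ck_on k S (f i)"
  shows "Ck_on k S (\<lambda>x. \<Prod>i\<in>I. f i x)"
  using assms(2)
proof (induction I rule: infinite_finite_induct)
  case (insert i I)
  then show ?case
    using Ck_on_bounded_bilinear[OF assms(1) bounded_bilinear_mult, of k "f i"] by simp
qed (simp_all add: Ck_on_const)

lemma Ck_on_inverse:
  fixes f :: "'a::real_normed_vector \<Rightarrow> real"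
  assumes "open S" "\<And>x. x \<in> S \<Longrightarrow> f x \<noteq> 0" "Ck_on k S f"
  shows "Ck_on k S (\<lambda>x. inverse (f x))"
  using assms(3)
proof (induction k)
  case 0
  then show ?case using assms(2) by (auto intro: continuous_on_inverse)
next
  case (Suc k)
  note mult = Ck_on_bounded_bilinear[OF assms(1) bounded_bilinear_mult]
  \<comment> \<open>The derivative of the reciprocal contains the reciprocal again, but only its
    regularity of order \<open>k\<close> is then required.\<close>
  have inv: "Ck_on k S (\<lambda>x. inverse (f x))"
    using Suc.IH[OF Ck_on_SucD[OF Suc.prems]] .
  show ?case
  proof (rule Ck_on_SucI[OF assms(1)])
    show "((\<lambda>x. inverse (f x)) has_derivative
        (\<lambda>v. (- 1) * (inverse (f x) * frechet_derivative f (at x) v * inverse (f x)))) (at x)"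
      if "x \<in> S" for x
      using Deriv.has_derivative_inverse[OF assms(2)[OF that] Ck_on_derivative[OF Suc.prems that]] by simp
    show "Ck_on k S (\<lambda>x. (- 1) * (inverse (f x) * frechet_derivative f (at x) v * inverse (f x)))" for v
      using Suc.prems by (intro mult inv Ck_on_const) auto
  qed
qed

lemma Ck_on_vec:
  fixes f :: "'a::real_normed_vector \<Rightarrow> ('b::real_normed_vector) ^ 'n"
  assumes "open S" "\<And>i. Ck_on k S (\<lambda>x. f x $ i)"
  shows "Ck_on k S f"
proof -
  have "bounded_linear (axis i :: 'b \<Rightarrow> 'b ^ 'n)" for i
    by (rule bounded_linear_intro[where K=1]) (auto simp: vec_eq_iff axis_def norm_vec_def L2_set_def
        if_distrib[of norm] if_distrib[of "\<lambda>x. x\<^sup>2"] cong: if_cong)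
  then have "Ck_on k S (\<lambda>x. \<Sum>i\<in>UNIV. axis i (f x $ i))"
    using Ck_on_bounded_linear[OF assms(1) _ assms(2)] by (intro Ck_on_sum assms(1)) blast
  moreover have "(\<Sum>i\<in>UNIV. axis i (f x $ i)) = f x" for x
    by (simp add: vec_eq_iff axis_def)
  ultimately show ?thesis by simp
qed

lemma Ck_on_compose:
  fixes g :: "'a::real_normed_vector \<Rightarrow> 'b::euclidean_space"
  assumes "open S" "open T" "g ` S \<subseteq> T" "Ck_on k T f" "Ck_on k S g"
  shows "Ck_on k S (\<lambda>x. f (g x))"
  using assms(4,5)
proof (induction k arbitrary: f)
  case 0
  then show ?case
    using assms(3) by (auto intro: continuous_on_compose2)
next
  case (Suc k)
  show ?case
  proof (rule Ck_on_SucI[OF assms(1)])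
    fix x assume x: "x \<in> S"
    let ?F = "frechet_derivative f (at (g x))" and ?G = "frechet_derivative g (at x)"
    have F: "(f has_derivative ?F) (at (g x))" and G: "(g has_derivative ?G) (at x)"
      using Ck_on_derivative Suc.prems x assms(3) by blast+
    \<comment> \<open>\<open>Ck_on\<close> speaks of derivatives in a fixed direction, whereas the
      chain rule applies the derivative of \<open>f\<close> in the direction \<open>?G v\<close>,
      which varies with \<open>x\<close>. Expanding it in the basis leaves fixed directions with
      scalar coefficients; this is why the middle space is Euclidean.\<close>
    have "?F (?G v) = (\<Sum>b\<in>Basis. (?G v \<bullet> b) *\<^sub>R ?F b)" for v
    proof -
      interpret F: bounded_linear ?F using F by (rule has_derivative_bounded_linear)
      have "?F (\<Sum>b\<in>Basis. (?G v \<bullet> b) *\<^sub>R b) = (\<Sum>b\<in>Basis. (?G v \<bullet> b) *\<^sub>R ?F b)"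
        by (simp add: F.sum F.scaleR)
      then show ?thesis by (simp add: euclidean_representation)
    qed
    then show "((\<lambda>x. f (g x)) has_derivative (\<lambda>v. \<Sum>b\<in>Basis. (?G v \<bullet> b) *\<^sub>R ?F b)) (at x)"
      using diff_chain_at[OF G F] by (simp add: o_def)
  next
    have "Ck_on k S (\<lambda>x. frechet_derivative f (at (g x)) b)" for b
      using Suc.prems Ck_on_SucD by (intro Suc.IH) auto
    then show "Ck_on k S (\<lambda>x. \<Sum>b\<in>Basis. (frechet_derivative g (at x) v \<bullet> b) *\<^sub>R
        frechet_derivative f (at (g x)) b)" for v
      using Suc.prems(2)
      by (intro Ck_on_sum assms(1) Ck_on_bounded_bilinear[OF _ bounded_bilinear_scaleR]
          Ck_on_bounded_bilinear[OF _ bounded_bilinear_inner] Ck_on_const) auto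
  qed
qed

section \<open>Smooth dependence of the inverse matrix, by Cramer's rule\<close>

lemma matrix_inv_both:
  fixes A :: "real ^ 'n ^ 'n"
  assumes "invertible A"
  shows "A ** matrix_inv A = mat 1" "matrix_inv A ** A = mat 1"
  using someI_ex[OF assms[unfolded invertible_def]] by (auto simp: matrix_inv_def)

lemma Ck_on_matrix_inv:
  fixes f :: "'a::real_normed_vector \<Rightarrow> real ^ 'n ^ 'n"
  assumes "open S" "\<And>x. x \<in> S \<Longrightarrow> invertible (f x)" "Ck_on k S f"
  shows "Ck_on k S (\<lambda>x. matrix_inv (f x))"
proof -
  \<comment> \<open>The matrix of Cramer's rule: \<open>f x\<close> with its column \<open>i\<close>
    replaced by the unit vector \<open>l\<close>. Its determinant is a polynomial in the entries,
    hence as regular as \<open>f\<close>.\<close>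
  define A where "A x i l = (\<chi> r s. if s = i then axis l 1 $ r else f x $ r $ s)" for x i l
  have entry: "Ck_on k S (\<lambda>x. f x $ r $ s)" for r s
    by (intro Ck_on_bounded_linear[OF assms(1) bounded_linear_vec_nth] assms(3))
  have det: "Ck_on k S (\<lambda>x. det (F x))"
    if "\<And>r s. Ck_on k S (\<lambda>x. F x $ r $ s)" for F :: "'a \<Rightarrow> real ^ 'n ^ 'n"
    unfolding det_def
    by (intro Ck_on_sum Ck_on_prod Ck_on_bounded_bilinear[OF assms(1) bounded_bilinear_mult]
        Ck_on_const assms(1) that)
  have "Ck_on k S (\<lambda>x. \<chi> i l. det (A x i l) * inverse (det (f x)))"
  proof -
    have "Ck_on k S (\<lambda>x. A x i l $ r $ s)" for i l r s
      by (cases "s = i") (auto simp: A_def entry Ck_on_const)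
    then have "Ck_on k S (\<lambda>x. det (A x i l) * inverse (det (f x)))" for i l
      using assms(2)
      by (intro Ck_on_bounded_bilinear[OF assms(1) bounded_bilinear_mult] det Ck_on_inverse
          assms(1) entry) (auto simp: invertible_det_nz)
    then show ?thesis
      by (intro Ck_on_vec assms(1)) simp
  qed
  moreover have "matrix_inv (f x) = (\<chi> i l. det (A x i l) * inverse (det (f x)))" if "x \<in> S" for x
  proof -
    have nz: "det (f x) \<noteq> 0"
      using assms(2)[OF that] by (simp add: invertible_det_nz)
    have "f x *v (matrix_inv (f x) *v axis l 1) = axis l 1" for l
      using matrix_inv_both(1)[OF assms(2)[OF that]] by (simp add: matrix_vector_mul_assoc)
    then have "matrix_inv (f x) *v axis l 1 = (\<chi> i. det (A x i l) / det (f x))" for l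
      unfolding cramer[OF nz] A_def .
    then have "matrix_inv (f x) $ i $ l = det (A x i l) / det (f x)" for i l
      by (simp add: matrix_vector_mult_basis column_def vec_eq_iff)
    then show ?thesis
      by (simp add: vec_eq_iff divide_inverse)
  qed
  ultimately show ?thesis
    using Ck_on_cong[OF assms(1)] by (metis (no_types, lifting))
qed

section \<open>Symmetry of second derivatives\<close>

lemma second_difference:
  fixes f :: "'a::real_normed_vector \<Rightarrow> real"
  assumes "Ck_on 2 S f" "t > 0"
    and "\<And>s r. \<lbrakk>0 \<le> s; s \<le> t; 0 \<le> r; r \<le> t\<rbrakk> \<Longrightarrow> x + s *\<^sub>R u + r *\<^sub>R v \<in> S"
  shows "\<exists>s r. 0 < s \<and> s < t \<and> 0 < r \<and> r < t \<and>
    f (x + t *\<^sub>R u + t *\<^sub>R v) - f (x + t *\<^sub>R u) - f (x + t *\<^sub>R v) + f x =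
      t * (t * frechet_derivative (\<lambda>y. frechet_derivative f (at y) u) (at (x + s *\<^sub>R u + r *\<^sub>R v)) v)"
proof -
  let ?fu = "\<lambda>y. frechet_derivative f (at y) u"
  have C: "Ck_on (Suc (Suc 0)) S f"
    using assms(1) by (simp add: numeral_2_eq_2)
  then have Cu: "Ck_on (Suc 0) S ?fu"
    by (simp only: Ck_on.simps(2)[of "Suc 0"])
  have df: "((\<lambda>s. f (x + s *\<^sub>R u + r *\<^sub>R v)) has_real_derivative ?fu (x + s *\<^sub>R u + r *\<^sub>R v)) (at s)"
    if "0 \<le> s" "s \<le> t" "0 \<le> r" "r \<le> t" for s r
  proof -
    let ?F = "frechet_derivative f (at (x + s *\<^sub>R u + r *\<^sub>R v))"
    have F: "(f has_derivative ?F) (at (x + s *\<^sub>R u + r *\<^sub>R v))"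
      by (intro Ck_on_derivative[OF C] assms(3) that)
    have "((\<lambda>s. x + s *\<^sub>R u + r *\<^sub>R v) has_derivative (\<lambda>h. h *\<^sub>R u)) (at s)"
      by (auto intro!: derivative_eq_intros)
    from diff_chain_at[OF this F] show ?thesis
      using has_derivative_bounded_linear[OF F]
      by (auto simp: o_def has_field_derivative_def fun_eq_iff
          bounded_linear.linear linear_cmul elim!: has_derivative_eq_rhs)
  qed
  have dfu: "((\<lambda>r. ?fu (x + s *\<^sub>R u + r *\<^sub>R v)) has_real_derivative
      frechet_derivative ?fu (at (x + s *\<^sub>R u + r *\<^sub>R v)) v) (at r)"
    if "0 \<le> s" "s \<le> t" "0 \<le> r" "r \<le> t" for s r
  proof -
    let ?F = "frechet_derivative ?fu (at (x + s *\<^sub>R u + r *\<^sub>R v))"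
    have F: "(?fu has_derivative ?F) (at (x + s *\<^sub>R u + r *\<^sub>R v))"
      by (intro Ck_on_derivative[OF Cu] assms(3) that)
    have "((\<lambda>r. x + s *\<^sub>R u + r *\<^sub>R v) has_derivative (\<lambda>h. h *\<^sub>R v)) (at r)"
      by (auto intro!: derivative_eq_intros)
    from diff_chain_at[OF this F] show ?thesis
      using has_derivative_bounded_linear[OF F]
      by (auto simp: o_def has_field_derivative_def fun_eq_iff
          bounded_linear.linear linear_cmul elim!: has_derivative_eq_rhs)
  qed
  \<comment> \<open>\<open>p t - p 0\<close> is the second difference over the parallelogram. The
    mean value theorem is applied to \<open>p\<close> in direction \<open>u\<close>, then to the
    resulting increment of \<open>?fu\<close> in direction \<open>v\<close>. The summand with factor
    0 keeps both terms in the form to which \<open>df\<close> applies.\<close>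
  define p where "p s = f (x + s *\<^sub>R u + t *\<^sub>R v) - f (x + s *\<^sub>R u + 0 *\<^sub>R v)" for s
  have "(p has_real_derivative ?fu (x + s *\<^sub>R u + t *\<^sub>R v) - ?fu (x + s *\<^sub>R u + 0 *\<^sub>R v)) (at s)"
    if "0 \<le> s" "s \<le> t" for s
    unfolding p_def using that \<open>t > 0\<close> by (intro DERIV_diff df) auto
  from MVT2[OF \<open>t > 0\<close> this] obtain s where s: "0 < s" "s < t"
    "p t - p 0 = (t - 0) * (?fu (x + s *\<^sub>R u + t *\<^sub>R v) - ?fu (x + s *\<^sub>R u + 0 *\<^sub>R v))"
    by blast
  have "((\<lambda>r. ?fu (x + s *\<^sub>R u + r *\<^sub>R v)) has_real_derivative
      frechet_derivative ?fu (at (x + s *\<^sub>R u + r *\<^sub>R v)) v) (at r)" if "0 \<le> r" "r \<le> t" for r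
    using s that by (intro dfu) auto
  from MVT2[OF \<open>t > 0\<close> this] obtain r where "0 < r" "r < t"
    "?fu (x + s *\<^sub>R u + t *\<^sub>R v) - ?fu (x + s *\<^sub>R u + 0 *\<^sub>R v) =
      (t - 0) * frechet_derivative ?fu (at (x + s *\<^sub>R u + r *\<^sub>R v)) v"
    by blast
  with s show ?thesis
    by (intro exI[of _ s] exI[of _ r]) (simp add: p_def)
qed

text \<open>The second difference over a parallelogram is symmetric in its two sides, so the two
  mixed derivatives take a common value at two points of it. Continuity transfers this to
  \<open>x\<close> as the parallelogram shrinks.\<close>

lemma mixed_derivatives_commute:
  fixes f :: "'a::real_normed_vector \<Rightarrow> real"
  assumes "open S" "x \<in> S" "Ck_on 2 S f"
  shows "frechet_derivative (\<lambda>y. frechet_derivative f (at y) u) (at x) v =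
    frechet_derivative (\<lambda>y. frechet_derivative f (at y) v) (at x) u"
proof -
  define F where "F u v y = frechet_derivative (\<lambda>y. frechet_derivative f (at y) u) (at y) v" for u v y
  have cont: "isCont (F u v) x" for u v
  proof -
    have "continuous_on S (F u v)"
      using assms(3) by (simp add: numeral_2_eq_2 F_def[abs_def])
    then show ?thesis
      using assms(1,2) continuous_on_eq_continuous_at by blast
  qed
  have "\<bar>F u v x - F v u x\<bar> < 2 * e" if "e > 0" for e
  proof -
    have "\<forall>\<^sub>F y in nhds x. y \<in> S \<and> dist (F u v y) (F u v x) < e \<and> dist (F v u y) (F v u x) < e"
      using cont[of u v] cont[of v u] that assms(1,2)
      by (intro eventually_conj eventually_nhds_in_open tendstoD)
        (auto simp: continuous_within tendsto_at_iff_tendsto_nhds)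
    then obtain d where "d > 0" and d: "\<And>y. dist y x < d \<Longrightarrow>
        y \<in> S \<and> dist (F u v y) (F u v x) < e \<and> dist (F v u y) (F v u x) < e"
      by (auto simp: eventually_nhds_metric)
    \<comment> \<open>Small enough for the whole parallelogram to stay within distance
      \<open>d\<close> of \<open>x\<close>; the summand 1 keeps the denominator positive when both
      directions vanish.\<close>
    define t where "t = d / (2 * (norm u + norm v + 1))"
    have pos: "norm u + norm v + 1 > 0"
      by (simp add: add_nonneg_pos)
    then have "t > 0" using \<open>d > 0\<close> by (simp add: t_def)
    have near: "dist (x + s *\<^sub>R u + r *\<^sub>R v) x < d" if "0 \<le> s" "s \<le> t" "0 \<le> r" "r \<le> t" for s r
    proof -
      have "dist (x + s *\<^sub>R u + r *\<^sub>R v) x \<le> s * norm u + r * norm v"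
        using norm_triangle_ineq[of "s *\<^sub>R u" "r *\<^sub>R v"] that by (simp add: dist_norm add.assoc)
      also have "\<dots> \<le> t * norm u + t * norm v"
        using that by (intro add_mono mult_right_mono) auto
      also have "\<dots> < t * (norm u + norm v + 1)"
        using \<open>t > 0\<close> by (simp add: distrib_left)
      also have "\<dots> = d / 2"
        using pos by (simp add: t_def divide_simps)
      also have "\<dots> < d"
        using \<open>d > 0\<close> by simp
      finally show ?thesis .
    qed
    have near': "dist (x + s *\<^sub>R v + r *\<^sub>R u) x < d" if "0 \<le> s" "s \<le> t" "0 \<le> r" "r \<le> t" for s r
      using near[of r s] that by (simp add: add_ac)
    obtain s r where 1: "0 < s" "s < t" "0 < r" "r < t"
      "f (x + t *\<^sub>R u + t *\<^sub>R v) - f (x + t *\<^sub>R u) - f (x + t *\<^sub>R v) + f x =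
        t * (t * F u v (x + s *\<^sub>R u + r *\<^sub>R v))"
      using second_difference[OF assms(3) \<open>t > 0\<close>, where x=x and u=u and v=v] d[OF near]
      unfolding F_def by metis
    obtain s' r' where 2: "0 < s'" "s' < t" "0 < r'" "r' < t"
      "f (x + t *\<^sub>R v + t *\<^sub>R u) - f (x + t *\<^sub>R v) - f (x + t *\<^sub>R u) + f x =
        t * (t * F v u (x + s' *\<^sub>R v + r' *\<^sub>R u))"
      using second_difference[OF assms(3) \<open>t > 0\<close>, where x=x and u=v and v=u] d[OF near']
      unfolding F_def by metis
    have "F u v (x + s *\<^sub>R u + r *\<^sub>R v) = F v u (x + s' *\<^sub>R v + r' *\<^sub>R u)"
    proof -
      have swap: "x + t *\<^sub>R v + t *\<^sub>R u = x + t *\<^sub>R u + t *\<^sub>R v"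
        by (simp add: add_ac)
      have "t * (t * F u v (x + s *\<^sub>R u + r *\<^sub>R v)) = t * (t * F v u (x + s' *\<^sub>R v + r' *\<^sub>R u))"
        using 1(5) 2(5) by (simp only: swap)
      then show ?thesis using \<open>t > 0\<close> by simp
    qed
    moreover have "dist (F u v (x + s *\<^sub>R u + r *\<^sub>R v)) (F u v x) < e"
      using d[OF near[of s r]] 1(1-4) by simp
    moreover have "dist (F v u (x + s' *\<^sub>R v + r' *\<^sub>R u)) (F v u x) < e"
      using d[OF near'[of s' r']] 2(1-4) by simp
    ultimately show ?thesis
      by (simp add: dist_real_def)
  qed
  \<comment> \<open>With \<open>e\<close> equal to half the gap, the bound would say that the gap is
    smaller than itself.\<close>
  from this[of "\<bar>F u v x - F v u x\<bar> / 2"] have "\<not> 0 < \<bar>F u v x - F v u x\<bar>"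
    by auto
  then show ?thesis by (simp add: F_def)
qed

section \<open>Charts\<close>

lemma chart_inv_snd:
  assumes "is_chart M c" "p \<in> fst c"
  shows "chart_inv c (snd c p) = p"
proof -
  have "fst c \<subseteq> topspace M"
    using assms(1) by (simp add: is_chart_def openin_subset)
  then have "inj_on (snd c) (fst c)"
    using assms(1) homeomorphic_imp_injective_map
    unfolding is_chart_def by (fastforce simp: Int_absorb1)
  then show ?thesis
    using assms(2) by (simp add: chart_inv_def)
qed

lemma snd_chart_inv: "x \<in> snd c ` fst c \<Longrightarrow> snd c (chart_inv c x) = x"
  by (simp add: chart_inv_def f_inv_into_f)

lemma open_chart_image:
  assumes "is_chart M c" "openin M U"
  shows "open (snd c ` (U \<inter> fst c))"
proof -
  have "open_map (subtopology M (fst c)) (top_of_set (snd c ` fst c)) (snd c)"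
    using assms(1) homeomorphic_imp_open_map unfolding is_chart_def by blast
  moreover have "openin (subtopology M (fst c)) (U \<inter> fst c)"
    using assms(2) by (auto simp: openin_subtopology)
  ultimately have "openin (top_of_set (snd c ` fst c)) (snd c ` (U \<inter> fst c))"
    unfolding open_map_def by blast
  then show ?thesis
    using assms(1) by (simp add: is_chart_def openin_open_eq)
qed

lemma smooth_atlasD:
  assumes "smooth_atlas M \<A>" "c \<in> \<A>"
  shows "is_chart M c" "openin M (fst c)" "fst c \<subseteq> topspace M"
  using assms by (auto simp: smooth_atlas_def is_chart_def openin_subset)

lemma open_overlap:
  assumes "smooth_atlas M \<A>" "c \<in> \<A>" "c' \<in> \<A>"
  shows "open (snd c ` (fst c \<inter> fst c'))" "open (snd c ` (fst c' \<inter> fst c))"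
  using open_chart_image[of M c "fst c'"] smooth_atlasD[OF assms(1)] assms(2,3)
  by (simp_all add: Int_commute)

lemma open_chart_range:
  "is_chart M c \<Longrightarrow> open (snd c ` fst c)"
  by (simp add: is_chart_def)

lemma smooth_transition:
  assumes "smooth_atlas M \<A>" "c \<in> \<A>" "c' \<in> \<A>"
  shows "Ck_on k (snd c ` (fst c \<inter> fst c')) (transition c c')"
  using assms by (auto simp: smooth_atlas_def smooth_on_def)

lemma transition_has_derivative:
  assumes "smooth_atlas M \<A>" "c \<in> \<A>" "c' \<in> \<A>" "p \<in> fst c" "p \<in> fst c'"
  shows "(transition c c' has_derivative (\<lambda>v. jac c c' p *v v)) (at (snd c p))"
proof -
  have "transition c c' differentiable (at (snd c p))"
    using smooth_transition[OF assms(1-3), of "Suc 0"] assms(4,5) by auto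
  then show ?thesis
    unfolding jac_def by (simp add: jacobian_works)
qed

lemma jac_eqI:
  assumes "smooth_atlas M \<A>" "c \<in> \<A>" "c' \<in> \<A>" "p \<in> fst c" "p \<in> fst c'"
    and "(transition c c' has_derivative (\<lambda>v. J *v v)) (at (snd c p))"
  shows "jac c c' p = J"
  using has_derivative_unique[OF transition_has_derivative[OF assms(1-5)] assms(6)]
  by (simp add: matrix_eq fun_eq_iff)

lemma jac_refl:
  assumes "smooth_atlas M \<A>" "c \<in> \<A>" "p \<in> fst c"
  shows "jac c c p = mat 1"
proof (rule jac_eqI[OF assms(1,2,2,3,3)])
  have "((\<lambda>x. x) has_derivative (\<lambda>v. v)) (at (snd c p))"
    by (rule has_derivative_ident)
  then have "(transition c c has_derivative (\<lambda>v. v)) (at (snd c p))"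
    by (rule has_derivative_transform_within_open[OF _ open_chart_range[OF smooth_atlasD(1)[OF assms(1,2)]]])
      (use assms(3) in \<open>auto simp: transition_def chart_inv_snd[OF smooth_atlasD(1)[OF assms(1,2)]]\<close>)
  then show "(transition c c has_derivative (\<lambda>v. mat 1 *v v)) (at (snd c p))"
    by simp
qed

lemma jac_trans:
  assumes "smooth_atlas M \<A>" "c \<in> \<A>" "c' \<in> \<A>" "c'' \<in> \<A>" "p \<in> fst c" "p \<in> fst c'" "p \<in> fst c''"
  shows "jac c c'' p = jac c' c'' p ** jac c c' p"
proof (rule jac_eqI[OF assms(1,2,4,5,7)])
  note inv = chart_inv_snd[OF smooth_atlasD(1)[OF assms(1)]]
  have c': "transition c c' (snd c p) = snd c' p"
    using assms by (simp add: transition_def inv)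
  have "((transition c' c'' \<circ> transition c c') has_derivative
      ((\<lambda>v. jac c' c'' p *v v) \<circ> (\<lambda>v. jac c c' p *v v))) (at (snd c p))"
    using transition_has_derivative[OF assms(1,3,4,6,7)]
    by (intro diff_chain_at transition_has_derivative[OF assms(1,2,3,5,6)]) (simp add: c')
  moreover have "open (snd c ` (fst c' \<inter> fst c'' \<inter> fst c))"
    by (intro open_chart_image[of M] openin_Int smooth_atlasD[OF assms(1)] assms(2-4))
  ultimately have "(transition c c'' has_derivative
      ((\<lambda>v. jac c' c'' p *v v) \<circ> (\<lambda>v. jac c c' p *v v))) (at (snd c p))"
    by (rule has_derivative_transform_within_open)
      (use assms in \<open>auto simp: transition_def inv\<close>)
  then show "(transition c c'' has_derivative (\<lambda>v. jac c' c'' p ** jac c c' p *v v)) (at (snd c p))"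
    by (simp add: o_def matrix_vector_mul_assoc)
qed

lemma coord_field_self:
  assumes "smooth_atlas M \<A>" "c \<in> \<A>" "p \<in> fst c"
  shows "coord_field c a c p = axis a 1"
  by (simp add: coord_field_def jac_refl[OF assms])

text \<open>The components in a chart \<open>c'\<close> are derivatives of the transition from
  \<open>c\<close> to \<open>c'\<close>, hence functions of the coordinates of \<open>c\<close>;
  composing with the opposite transition makes them smooth in those of \<open>c'\<close>. The
  transformation law is the chain rule for \<open>jac\<close>.\<close>

lemma vector_field_coord_field:
  assumes "smooth_atlas M \<A>" "c \<in> \<A>"
  shows "vector_field \<A> (fst c) (coord_field c a)"
  unfolding vector_field_def smooth_family_def
proof (intro conjI ballI)
  fix c' assume c': "c' \<in> \<A>"
  note inv = chart_inv_snd[OF smooth_atlasD(1)[OF assms(1)]]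
  let ?S = "snd c' ` (fst c \<inter> fst c')" and ?T = "snd c ` (fst c \<inter> fst c')"
  have S: "open ?S" and T: "open ?T"
    using open_overlap[OF assms(1)] assms(2) c' by blast+
  have "Ck_on k ?S (\<lambda>x. frechet_derivative (transition c c') (at (transition c' c x)) (axis a 1))" for k
  proof (rule Ck_on_compose[OF S T,
        where f = "\<lambda>y. frechet_derivative (transition c c') (at y) (axis a 1)" and g = "transition c' c"])
    show "transition c' c ` ?S \<subseteq> ?T"
      using inv[OF c'] by (auto simp: transition_def)
    show "Ck_on k ?T (\<lambda>y. frechet_derivative (transition c c') (at y) (axis a 1))"
      using smooth_transition[OF assms c', of "Suc k"] by simp
    show "Ck_on k ?S (transition c' c)"
      using smooth_transition[OF assms(1) c' assms(2), of k] by (simp add: Int_commute)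
  qed
  then have "Ck_on k ?S (\<lambda>x. coord_field c a c' (chart_inv c' x))" for k
  proof (rule Ck_on_cong[OF S, rotated])
    fix x assume "x \<in> ?S"
    then obtain p where p: "p \<in> fst c" "p \<in> fst c'" "x = snd c' p" by blast
    then have "transition c' c x = snd c p"
      by (simp add: transition_def inv c')
    then show "frechet_derivative (transition c c') (at (transition c' c x)) (axis a 1) =
        coord_field c a c' (chart_inv c' x)"
      using frechet_derivative_eqI[OF transition_has_derivative[OF assms c' p(1,2)]]
      by (simp add: coord_field_def p(2,3) inv c')
  qed
  then show "smooth_on ?S (\<lambda>x. coord_field c a c' (chart_inv c' x))"
    by (simp add: smooth_on_def)
next
  fix c' c'' p assume "c' \<in> \<A>" "c'' \<in> \<A>" "p \<in> fst c \<inter> fst c' \<inter> fst c''"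
  then show "coord_field c a c'' p = jac c' c'' p *v coord_field c a c' p"
    using jac_trans[OF assms, of c' c'' p] by (simp add: coord_field_def matrix_vector_mul_assoc)
qed


section \<open>Partial derivatives in a chart\<close>

definition differentiable_in_chart :: "('m, 'n::finite) chart \<Rightarrow> ('m \<Rightarrow> real) \<Rightarrow> 'm \<Rightarrow> bool"
  where "differentiable_in_chart c f p \<longleftrightarrow> (\<lambda>x. f (chart_inv c x)) differentiable (at (snd c p))"

lemma has_derivative_in_chart:
  "differentiable_in_chart c f p \<Longrightarrow>
    ((\<lambda>x. f (chart_inv c x)) has_derivative
      frechet_derivative (\<lambda>x. f (chart_inv c x)) (at (snd c p))) (at (snd c p))"
  by (simp add: differentiable_in_chart_def flip: frechet_derivative_works)

lemma partial_deriv_eqI: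
  "((\<lambda>x. f (chart_inv c x)) has_derivative F) (at (snd c p)) \<Longrightarrow> partial_deriv c k f p = F (axis k 1)"
  by (simp add: partial_deriv_def frechet_derivative_eqI)

lemma differentiable_in_chart_intros:
  assumes "differentiable_in_chart c f p" "differentiable_in_chart c g p"
  shows "differentiable_in_chart c (\<lambda>q. f q + g q) p" "differentiable_in_chart c (\<lambda>q. f q * g q) p"
  using assms by (simp_all add: differentiable_in_chart_def)

lemma partial_deriv_const [simp]: "partial_deriv c k (\<lambda>q. r) p = 0"
  by (simp add: partial_deriv_def)

lemma differentiable_in_chart_const: "differentiable_in_chart c (\<lambda>q. r) p"
  by (simp add: differentiable_in_chart_def)

lemma partial_deriv_add:
  assumes "differentiable_in_chart c f p" "differentiable_in_chart c g p"
  shows "partial_deriv c k (\<lambda>q. f q + g q) p = partial_deriv c k f p + partial_deriv c k g p"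
  using has_derivative_add[OF assms[THEN has_derivative_in_chart]]
  by (subst partial_deriv_eqI, assumption) (simp add: partial_deriv_def)

lemma partial_deriv_mult:
  assumes "differentiable_in_chart c f p" "differentiable_in_chart c g p"
    and "chart_inv c (snd c p) = p"
  shows "partial_deriv c k (\<lambda>q. f q * g q) p =
    f p * partial_deriv c k g p + partial_deriv c k f p * g p"
  using has_derivative_mult[OF assms(1,2)[THEN has_derivative_in_chart]]
  by (subst partial_deriv_eqI, assumption) (simp add: partial_deriv_def assms(3))

lemma partial_deriv_sum:
  assumes "\<And>i. i \<in> I \<Longrightarrow> differentiable_in_chart c (f i) p"
  shows "partial_deriv c k (\<lambda>q. \<Sum>i\<in>I. f i q) p = (\<Sum>i\<in>I. partial_deriv c k (f i) p)"
  using has_derivative_sum[of I, OF assms[THEN has_derivative_in_chart]]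
  by (subst partial_deriv_eqI, assumption) (simp add: partial_deriv_def)

lemma partial_deriv_cong:
  assumes "is_chart M c" "p \<in> fst c" "\<And>q. q \<in> fst c \<Longrightarrow> f q = g q"
  shows "partial_deriv c k f p = partial_deriv c k g p"
proof -
  have eq: "f (chart_inv c x) = g (chart_inv c x)" if "x \<in> snd c ` fst c" for x
    using that assms(3) chart_inv_snd[OF assms(1)] by auto
  have "((\<lambda>x. f (chart_inv c x)) has_derivative F) (at (snd c p)) \<longleftrightarrow>
      ((\<lambda>x. g (chart_inv c x)) has_derivative F) (at (snd c p))" for F
    by (rule iffI; erule has_derivative_transform_within_open[OF _ open_chart_range[OF assms(1)]])
      (use assms(2) in \<open>simp_all add: eq\<close>)
  then show ?thesis
    by (simp add: partial_deriv_def frechet_derivative_def)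
qed

lemma partial_deriv_commute:
  assumes "is_chart M c" "p \<in> fst c" "Ck_on 2 (snd c ` fst c) (\<lambda>x. f (chart_inv c x))"
  shows "partial_deriv c k (partial_deriv c l f) p = partial_deriv c l (partial_deriv c k f) p"
proof -
  let ?S = "snd c ` fst c" and ?f = "\<lambda>x. f (chart_inv c x)"
  have S: "open ?S" "snd c p \<in> ?S"
    using open_chart_range[OF assms(1)] assms(2) by auto
  have "partial_deriv c k (partial_deriv c l f) p =
      frechet_derivative (\<lambda>x. frechet_derivative ?f (at x) (axis l 1)) (at (snd c p)) (axis k 1)" for k l
  proof -
    have "Ck_on (Suc 0) ?S (\<lambda>x. frechet_derivative ?f (at x) (axis l 1))"
      using assms(3) by (simp add: numeral_2_eq_2)
    from has_derivative_transform_within_open[OF Ck_on_derivative[OF this S(2)] S]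
    have "((\<lambda>x. partial_deriv c l f (chart_inv c x)) has_derivative
       frechet_derivative (\<lambda>x. frechet_derivative ?f (at x) (axis l 1)) (at (snd c p))) (at (snd c p))"
      by (simp add: partial_deriv_def snd_chart_inv)
    then show ?thesis by (rule partial_deriv_eqI)
  qed
  then show ?thesis
    using mixed_derivatives_commute[OF S assms(3)] by simp
qed

text \<open>The functional \<open>L\<close> picks out a component, so that vectors, covectors and
  matrices are treated alike.\<close>

lemma smooth_family_differentiable_in_chart:
  fixes F :: "('m, 'n::finite) chart \<Rightarrow> 'm \<Rightarrow> 'b::real_normed_vector"
  assumes "smooth_family \<A> U F" "c \<in> \<A>" "p \<in> fst c" "fst c \<subseteq> U" "is_chart M c" "bounded_linear L"
  shows "differentiable_in_chart c (\<lambda>q. L (F c q)) p"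
    and "Ck_on k (snd c ` fst c) (\<lambda>x. L (F c (chart_inv c x)))"
proof -
  have "Ck_on k (snd c ` fst c) (\<lambda>x. L (F c (chart_inv c x)))" for k
  proof (rule Ck_on_bounded_linear[OF open_chart_range[OF assms(5)] assms(6)])
    show "Ck_on k (snd c ` fst c) (\<lambda>x. F c (chart_inv c x))"
      using assms(1,2,4) by (auto simp: smooth_family_def smooth_on_def Int_absorb1)
  qed
  from this[of "Suc 0"] this[of k] show "differentiable_in_chart c (\<lambda>q. L (F c q)) p"
    "Ck_on k (snd c ` fst c) (\<lambda>x. L (F c (chart_inv c x)))"
    using assms(3) by (auto simp: differentiable_in_chart_def)
qed

section \<open>Connections in coordinates\<close>

lemma affine_connection_vector_field:
  "\<lbrakk>affine_connection M \<A> D; openin M U; vector_field \<A> U X; vector_field \<A> U Y\<rbrakk>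
    \<Longrightarrow> vector_field \<A> U (D U X Y)"
  unfolding affine_connection_def by (drule conjunct2, drule conjunct1) blast

lemma christoffel_differentiable:
  assumes "smooth_atlas M \<A>" "c \<in> \<A>" "p \<in> fst c" "affine_connection M \<A> D"
  shows "differentiable_in_chart c (\<lambda>q. christoffel D c q a b d) p"
proof -
  have "smooth_family \<A> (fst c) (D (fst c) (coord_field c d) (coord_field c b))"
    using affine_connection_vector_field[OF assms(4) smooth_atlasD(2)[OF assms(1,2)]
        vector_field_coord_field[OF assms(1,2)] vector_field_coord_field[OF assms(1,2)]]
    by (simp add: vector_field_def)
  then show ?thesis
    unfolding christoffel_def
    by (rule smooth_family_differentiable_in_chart(1)[OF _ assms(2,3) order_refl
        smooth_atlasD(1)[OF assms(1,2)] bounded_linear_vec_nth])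
qed

text \<open>In its own chart a coordinate field has constant components, so coordinate fields
  commute and vanishing torsion becomes symmetry in the lower indices.\<close>

lemma christoffel_sym:
  assumes "smooth_atlas M \<A>" "c \<in> \<A>" "p \<in> fst c" "torsion_free_connection M \<A> D"
  shows "christoffel D c p a b d = christoffel D c p a d b"
proof -
  note vf = vector_field_coord_field[OF assms(1,2)]
  have zero: "dir_deriv c X (coord_field c b c) p = 0" for X b
  proof -
    have "((\<lambda>x. coord_field c b c (chart_inv c x)) has_derivative (\<lambda>v. 0)) (at (snd c p))"
      by (rule has_derivative_transform_within_open[OF has_derivative_const[of "axis b 1"]
            open_chart_range[OF smooth_atlasD(1)[OF assms(1,2)]]])
        (use assms(3) in \<open>auto simp: coord_field_self[OF assms(1,2)]
          chart_inv_snd[OF smooth_atlasD(1)[OF assms(1,2)]]\<close>)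
    then show ?thesis
      by (simp add: dir_deriv_def frechet_derivative_eqI)
  qed
  have "eq_field \<A> (fst c)
      (\<lambda>c' p. D (fst c) (coord_field c d) (coord_field c b) c' p
        - D (fst c) (coord_field c b) (coord_field c d) c' p)
      (lie_bracket (coord_field c d) (coord_field c b))"
    using assms(4) smooth_atlasD(2)[OF assms(1,2)] vf unfolding torsion_free_connection_def by blast
  then have "D (fst c) (coord_field c d) (coord_field c b) c p
      - D (fst c) (coord_field c b) (coord_field c d) c p
      = lie_bracket (coord_field c d) (coord_field c b) c p"
    using assms(2,3) by (simp add: eq_field_def)
  then show ?thesis
    by (simp add: lie_bracket_def zero christoffel_def)
qed

text \<open>Names the 1-form hidden by the quantifier in \<open>projectively_equivalent\<close>, so
  that all the transformation formulas refer to the same \<open>A\<close>.\<close>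

definition projective_change ::
    "'m topology \<Rightarrow> ('m, 'n::finite) chart set \<Rightarrow> ('m, 'n) form_field \<Rightarrow>
      ('m, 'n) connection \<Rightarrow> ('m, 'n) connection \<Rightarrow> bool"
  where "projective_change M \<A> A D D' \<longleftrightarrow> one_form \<A> (topspace M) A \<and>
    (\<forall>U X Y. openin M U \<and> vector_field \<A> U X \<and> vector_field \<A> U Y \<longrightarrow>
       eq_field \<A> U (D' U X Y)
         (\<lambda>c p. D U X Y c p + (A c p \<bullet> X c p) *\<^sub>R Y c p + (A c p \<bullet> Y c p) *\<^sub>R X c p))"

lemma christoffel_projective:
  assumes "smooth_atlas M \<A>" "c \<in> \<A>" "p \<in> fst c"
    and "projective_change M \<A> A D D'"
  shows "christoffel D' c p a b d =
    christoffel D c p a b d + A c p $ d * kronecker a b + A c p $ b * kronecker a d"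
proof -
  let ?X = "coord_field c d" and ?Y = "coord_field c b"
  have "D' (fst c) ?X ?Y c p =
      D (fst c) ?X ?Y c p + (A c p \<bullet> ?X c p) *\<^sub>R ?Y c p + (A c p \<bullet> ?Y c p) *\<^sub>R ?X c p"
    using assms(4) smooth_atlasD(2)[OF assms(1,2)] vector_field_coord_field[OF assms(1,2)] assms(2,3)
    by (simp add: projective_change_def eq_field_def)
  then show ?thesis
    by (simp add: christoffel_def coord_field_self[OF assms(1-3)] inner_axis kronecker_def)
      (simp add: axis_def)
qed

text \<open>Compatibility is tested on coordinate fields, whose pairing under \<open>h\<close> is a
  matrix entry throughout the chart domain, so that it may be differentiated.\<close>

lemma metric_compatible:
  assumes "smooth_atlas M \<A>" "c \<in> \<A>" "p \<in> fst c" "levi_civita_connection M \<A> h D"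
  shows "partial_deriv c k (\<lambda>q. h c q $ a $ b) p =
    (\<Sum>e\<in>UNIV. christoffel D c p e a k * h c p $ e $ b + h c p $ a $ e * christoffel D c p e b k)"
proof -
  note vf = vector_field_coord_field[OF assms(1,2)] and self = coord_field_self[OF assms(1,2)]
  have entry: "x \<bullet> (B *v axis j 1) = (\<Sum>e\<in>UNIV. x $ e * B $ e $ j)"
    "axis i 1 \<bullet> (B *v x) = (\<Sum>e\<in>UNIV. B $ i $ e * x $ e)" for x :: "real ^ 'b" and B i j
    by (simp_all add: inner_vec_def matrix_vector_mult_def axis_def if_distrib[of "\<lambda>x. _ * x"]
        if_distrib[of "\<lambda>x. x * _"] cong: if_cong)
  have "dir_deriv c (coord_field c k) (\<lambda>q. coord_field c a c q \<bullet> (h c q *v coord_field c b c q)) p =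
      D (fst c) (coord_field c k) (coord_field c a) c p \<bullet> (h c p *v coord_field c b c p) +
      coord_field c a c p \<bullet> (h c p *v D (fst c) (coord_field c k) (coord_field c b) c p)"
    using assms(2-4) smooth_atlasD(2)[OF assms(1,2)] vf unfolding levi_civita_connection_def by blast
  also have "\<dots> = (\<Sum>e\<in>UNIV. christoffel D c p e a k * h c p $ e $ b) +
      (\<Sum>e\<in>UNIV. h c p $ a $ e * christoffel D c p e b k)"
    unfolding self[OF assms(3)] entry by (simp add: christoffel_def)
  also have "dir_deriv c (coord_field c k) (\<lambda>q. coord_field c a c q \<bullet> (h c q *v coord_field c b c q)) p =
      partial_deriv c k (\<lambda>q. coord_field c a c q \<bullet> (h c q *v coord_field c b c q)) p"
    by (simp add: dir_deriv_def partial_deriv_def self[OF assms(3)])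
  also have "\<dots> = partial_deriv c k (\<lambda>q. h c q $ a $ b) p"
  proof (rule partial_deriv_cong[OF smooth_atlasD(1)[OF assms(1,2)] assms(3)])
    show "coord_field c a c q \<bullet> (h c q *v coord_field c b c q) = h c q $ a $ b" if "q \<in> fst c" for q
      unfolding self[OF that] entry by (simp add: axis_def if_distrib[of "\<lambda>x. x * _"] cong: if_cong)
  qed
  finally show ?thesis by (simp add: sum.distrib)
qed

section \<open>Curvature\<close>

lemma sum_kronecker [simp]:
  fixes f :: "'n::finite \<Rightarrow> real"
  shows "(\<Sum>e\<in>UNIV. f e * kronecker a e) = f a" "(\<Sum>e\<in>UNIV. f e * kronecker e a) = f a"
    "(\<Sum>e\<in>UNIV. kronecker a e * f e) = f a" "(\<Sum>e\<in>UNIV. kronecker e a * f e) = f a"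
  by (simp_all add: kronecker_def if_distrib[of "\<lambda>x. _ * x"] if_distrib[of "\<lambda>x. x * _"] cong: if_cong)

text \<open>The right-hand side is sorted for antisymmetrization in \<open>k\<close> and
  \<open>d\<close>: for symmetric \<Gamma>, apart from the original product of \<Gamma> with itself,
  only terms with \<open>kronecker a k\<close> or \<open>kronecker a d\<close> survive.\<close>

lemma christoffel_product_projective:
  fixes \<Gamma> :: "'n::finite \<Rightarrow> 'n \<Rightarrow> 'n \<Rightarrow> real"
  shows "(\<Sum>e\<in>UNIV. (\<Gamma> a e k + A k * kronecker a e + A e * kronecker a k) *
        (\<Gamma> e b d + A d * kronecker e b + A b * kronecker e d)) =
    (\<Sum>e\<in>UNIV. \<Gamma> a e k * \<Gamma> e b d) + A d * \<Gamma> a b k + A b * \<Gamma> a d k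
      + A k * \<Gamma> a b d + A k * A d * kronecker a b + A k * A b * kronecker a d
      + kronecker a k * ((\<Sum>e\<in>UNIV. A e * \<Gamma> e b d) + 2 * A b * A d)"
proof -
  \<comment> \<open>Each delta that involves the summation index is moved to the end of its
    monomial, where \<open>sum_kronecker\<close> removes the sum.\<close>
  have "(\<Gamma> a e k + A k * kronecker a e + A e * kronecker a k) *
      (\<Gamma> e b d + A d * kronecker e b + A b * kronecker e d) =
    \<Gamma> a e k * \<Gamma> e b d + (A d * \<Gamma> a e k) * kronecker e b + (A b * \<Gamma> a e k) * kronecker e d
      + (A k * \<Gamma> e b d) * kronecker a e + (A k * A d * kronecker e b) * kronecker a e
      + (A k * A b * kronecker e d) * kronecker a e
      + kronecker a k * (A e * \<Gamma> e b d) + (kronecker a k * A d * A e) * kronecker e b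
      + (kronecker a k * A b * A e) * kronecker e d" for e
    by (simp add: algebra_simps)
  then show ?thesis
    by (simp add: sum.distrib flip: sum_distrib_left) (simp add: algebra_simps)
qed

text \<open>\<open>Q\<^sub>k\<^sub>b = \<nabla>\<^sub>kA\<^sub>b - A\<^sub>kA\<^sub>b\<close> is the tensor by which
  the Schouten tensor drops under the projective change given by \<open>A\<close>.\<close>

definition schouten_defect ::
    "('m, 'n::finite) connection \<Rightarrow> ('m, 'n) form_field \<Rightarrow> ('m, 'n) chart \<Rightarrow> 'm \<Rightarrow> 'n \<Rightarrow> 'n \<Rightarrow> real"
  where "schouten_defect D A c p k b = partial_deriv c k (\<lambda>q. A c q $ b) p
    - (\<Sum>e\<in>UNIV. A c p $ e * christoffel D c p e b k) - A c p $ k * A c p $ b"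

text \<open>In \<open>Q k d - Q d k\<close> the Christoffel and quadratic parts cancel and the
  exterior derivative of \<open>A\<close> remains, which comes from differentiating the term
  \<open>A c q $ d * kronecker a b\<close>. The other two terms join derivatives of \<open>A\<close>
  with the surviving quadratic ones.\<close>

lemma curvature_projective:
  assumes "smooth_atlas M \<A>" "c \<in> \<A>" "p \<in> fst c" "torsion_free_connection M \<A> D"
    and "projective_change M \<A> A D D'"
  defines "Q \<equiv> schouten_defect D A c p"
  shows "curvature D' c p a b k d = curvature D c p a b k d
    + kronecker a b * (Q k d - Q d k) + kronecker a d * Q k b - kronecker a k * Q d b"
proof -
  note change = christoffel_projective[OF assms(1,2) _ assms(5)]
  have aff: "affine_connection M \<A> D"
    using assms(4) by (simp add: torsion_free_connection_def)
  have A: "differentiable_in_chart c (\<lambda>q. A c q $ i) p" for i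
    by (rule smooth_family_differentiable_in_chart(1)[OF _ assms(2,3) smooth_atlasD(3,1)[OF assms(1,2)]
        bounded_linear_vec_nth]) (use assms(5) in \<open>auto simp: projective_change_def one_form_def\<close>)
  note const = differentiable_in_chart_const
  note cinv = chart_inv_snd[OF smooth_atlasD(1)[OF assms(1,2)] assms(3)]
  have deriv: "partial_deriv c k (\<lambda>q. christoffel D' c q a b d) p =
      partial_deriv c k (\<lambda>q. christoffel D c q a b d) p
      + partial_deriv c k (\<lambda>q. A c q $ d) p * kronecker a b
      + partial_deriv c k (\<lambda>q. A c q $ b) p * kronecker a d" for k d
  proof -
    have "partial_deriv c k (\<lambda>q. christoffel D' c q a b d) p =
        partial_deriv c k (\<lambda>q. christoffel D c q a b d + A c q $ d * kronecker a b + A c q $ b * kronecker a d) p"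
      by (rule partial_deriv_cong[OF smooth_atlasD(1)[OF assms(1,2)] assms(3)]) (rule change)
    then show ?thesis
      by (simp add: partial_deriv_add partial_deriv_mult[OF A const cinv] A const
          differentiable_in_chart_intros christoffel_differentiable[OF assms(1-3) aff])
  qed
  note sym = christoffel_sym[OF assms(1-4)]
  show ?thesis
    unfolding curvature_def deriv change[OF assms(3)] sum_subtractf christoffel_product_projective Q_def
      schouten_defect_def sym[of a d k] sym[of _ d k]
    by (simp add: algebra_simps)
qed

text \<open>Explains the weights in the Schouten tensor: Ricci changes by
  \<open>Q a b - n * Q b a\<close>, so its symmetric part changes by \<open>1 - n\<close> times that
  of \<open>Q\<close> and its skew part by \<open>n + 1\<close> times that of \<open>Q\<close>. The
  weights turn both into \<open>- Q\<close>.\<close>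

lemma schouten_projective:
  fixes D :: "('m, 'n::finite) connection"
  assumes "CARD('n) \<ge> 2"
    and "\<And>a b k d. curvature D' c p a b k d = curvature D c p a b k d
      + kronecker a b * (Q k d - Q d k) + kronecker a d * Q k b - kronecker a k * Q d b"
  shows "schouten D' c p a b = schouten D c p a b - Q a b"
proof -
  define n where "n = real CARD('n)"
  have n: "n - 1 \<noteq> 0" "n + 1 \<noteq> 0"
    using assms(1) by (simp_all add: n_def)
  have ric: "ricci D' c p a b = ricci D c p a b + Q a b - n * Q b a" for a b
    by (simp add: ricci_def assms(2) sum.distrib sum_subtractf algebra_simps n_def)
      (simp add: kronecker_def)
  have "1 / (n - 1) * ((ricci D' c p a b + ricci D' c p b a) / 2) =
      1 / (n - 1) * ((ricci D c p a b + ricci D c p b a) / 2) - (Q a b + Q b a) / 2"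
    using n(1) by (simp add: ric field_simps)
  moreover have "1 / (n + 1) * ((ricci D' c p a b - ricci D' c p b a) / 2) =
      1 / (n + 1) * ((ricci D c p a b - ricci D c p b a) / 2) + (Q a b - Q b a) / 2"
    using n(2) by (simp add: ric field_simps)
  ultimately have "schouten D' c p a b = schouten D c p a b - (Q a b + Q b a) / 2 - (Q a b - Q b a) / 2"
    unfolding schouten_def n_def[symmetric] by (simp only:)
  then show ?thesis
    by (simp add: field_simps)
qed

text \<open>Replacing the Schouten tensor \<open>P\<close> by \<open>P - Q\<close> in the three
  correction terms produces exactly the negative of the change of the curvature.\<close>

lemma projective_weyl_invariant:
  fixes \<A> :: "('m, 'n::finite) chart set"
  assumes "CARD('n) \<ge> 2" "smooth_atlas M \<A>" "c \<in> \<A>" "p \<in> fst c" "torsion_free_connection M \<A> D"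
    and "projectively_equivalent M \<A> D D'"
  shows "projective_weyl D' c p a b k d = projective_weyl D c p a b k d"
proof -
  obtain A where A: "projective_change M \<A> A D D'"
    using assms(6) unfolding projectively_equivalent_def projective_change_def by blast
  note curv = curvature_projective[OF assms(2-5) A]
  show ?thesis
    unfolding projective_weyl_def schouten_projective[OF assms(1) curv] curv
    by (simp add: field_simps)
qed

section \<open>Symmetries of the curvature\<close>

lemma first_bianchi:
  assumes "smooth_atlas M \<A>" "c \<in> \<A>" "p \<in> fst c" "torsion_free_connection M \<A> D"
  shows "curvature D c p a b k d + curvature D c p a k d b + curvature D c p a d b k = 0"
proof -
  note sym = christoffel_sym[OF assms(1,2) _ assms(4)]
  have dsym: "partial_deriv c i (\<lambda>q. christoffel D c q a j l) p =
      partial_deriv c i (\<lambda>q. christoffel D c q a l j) p" for i j l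
    by (rule partial_deriv_cong[OF smooth_atlasD(1)[OF assms(1,2)] assms(3)]) (rule sym)
  \<comment> \<open>Once the lower indices are put in a common order, derivatives and products
    cancel in pairs in the cyclic sum.\<close>
  show ?thesis
    unfolding curvature_def sum_subtractf
      dsym[of k d b] dsym[of d b k] dsym[of b k d]
      sym[OF assms(3), of _ d b] sym[OF assms(3), of _ b k] sym[OF assms(3), of _ k d]
    by simp
qed

lemma curvature_skew:
  "curvature D c p a b d k = - curvature D c p a b k d"
  by (simp add: curvature_def sum_subtractf)

text \<open>The Ricci identity for the parallel tensor \<open>h\<close>: differentiating
  \<open>\<partial>\<^sub>dh = \<Gamma>\<^sub>d\<^sup>Th + h\<Gamma>\<^sub>d\<close> once more and antisymmetrizing kills the left-hand side.\<close>

lemma curvature_metric_skew: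
  assumes "smooth_atlas M \<A>" "c \<in> \<A>" "p \<in> fst c"
    and "pseudo_riemannian_metric M \<A> h" "levi_civita_connection M \<A> h D"
  shows "(\<Sum>e\<in>UNIV. curvature D c p e a k d * h c p $ e $ b)
    + (\<Sum>e\<in>UNIV. h c p $ a $ e * curvature D c p e b k d) = 0"
proof -
  let ?\<Gamma> = "christoffel D c" and ?h = "\<lambda>a b q. h c q $ a $ b"
  note chart = smooth_atlasD(1)[OF assms(1,2)]
  have sf: "smooth_family \<A> (topspace M) h"
    using assms(4) by (simp add: pseudo_riemannian_metric_def)
  have L: "bounded_linear (\<lambda>B::real^'b^'b. B $ a $ b)" for a b
    by (rule bounded_linear_compose[OF bounded_linear_vec_nth bounded_linear_vec_nth])
  note smooth = smooth_family_differentiable_in_chart[OF sf assms(2,3) smooth_atlasD(3)[OF assms(1,2)] chart L]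
  have aff: "affine_connection M \<A> D"
    using assms(5) by (simp add: levi_civita_connection_def torsion_free_connection_def)
  note diff = christoffel_differentiable[OF assms(1-3) aff]
  note cinv = chart_inv_snd[OF chart assms(3)]
  note mc = metric_compatible[OF assms(1,2) _ assms(5)]
  define d\<Gamma> where "d\<Gamma> i e j l = partial_deriv c i (\<lambda>q. ?\<Gamma> q e j l) p" for i e j l
  \<comment> \<open>The first derivatives of \<open>h\<close> are eliminated by compatibility. Of
    the six sums, those with both \<Gamma> factors on the same side of \<open>h\<close> join the
    derivatives of \<Gamma> to form curvature; the two with one factor on each side are the cross
    terms.\<close>
  have second: "partial_deriv c i (partial_deriv c j (?h a b)) p =
      (\<Sum>e\<in>UNIV. d\<Gamma> i e a j * ?h e b p) + (\<Sum>e\<in>UNIV. ?h a e p * d\<Gamma> i e b j)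
      + (\<Sum>e\<in>UNIV. \<Sum>f\<in>UNIV. ?\<Gamma> p e a j * ?\<Gamma> p f e i * ?h f b p)
      + (\<Sum>e\<in>UNIV. \<Sum>f\<in>UNIV. ?\<Gamma> p e a j * ?h e f p * ?\<Gamma> p f b i)
      + (\<Sum>e\<in>UNIV. \<Sum>f\<in>UNIV. ?\<Gamma> p f a i * ?h f e p * ?\<Gamma> p e b j)
      + (\<Sum>e\<in>UNIV. \<Sum>f\<in>UNIV. ?h a f p * ?\<Gamma> p f e i * ?\<Gamma> p e b j)" for i j
  proof -
    have "partial_deriv c i (partial_deriv c j (?h a b)) p =
      partial_deriv c i (\<lambda>q. \<Sum>e\<in>UNIV. ?\<Gamma> q e a j * ?h e b q + ?h a e q * ?\<Gamma> q e b j) p"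
      by (rule partial_deriv_cong[OF chart assms(3)]) (rule mc)
    also have "\<dots> = (\<Sum>e\<in>UNIV. ?\<Gamma> p e a j * partial_deriv c i (?h e b) p + d\<Gamma> i e a j * ?h e b p
        + (?h a e p * d\<Gamma> i e b j + partial_deriv c i (?h a e) p * ?\<Gamma> p e b j))"
      by (simp add: partial_deriv_sum partial_deriv_add partial_deriv_mult cinv smooth(1) diff
          differentiable_in_chart_intros d\<Gamma>_def)
    also have "\<dots> = (\<Sum>e\<in>UNIV. d\<Gamma> i e a j * ?h e b p) + (\<Sum>e\<in>UNIV. ?h a e p * d\<Gamma> i e b j)
      + (\<Sum>e\<in>UNIV. ?\<Gamma> p e a j * partial_deriv c i (?h e b) p)
      + (\<Sum>e\<in>UNIV. partial_deriv c i (?h a e) p * ?\<Gamma> p e b j)"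
      by (simp add: sum.distrib)
    finally show ?thesis
      unfolding mc[OF assms(3)]
      by (simp add: sum.distrib sum_distrib_left sum_distrib_right distrib_left distrib_right mult.assoc)
  qed
  have curv: "curvature D c p e j k d = d\<Gamma> k e j d - d\<Gamma> d e j k
      + (\<Sum>f\<in>UNIV. ?\<Gamma> p e f k * ?\<Gamma> p f j d) - (\<Sum>f\<in>UNIV. ?\<Gamma> p e f d * ?\<Gamma> p f j k)" for e j
    by (simp add: curvature_def d\<Gamma>_def sum_subtractf)
  have left: "(\<Sum>e\<in>UNIV. curvature D c p e a k d * ?h e b p) =
      (\<Sum>e\<in>UNIV. d\<Gamma> k e a d * ?h e b p) - (\<Sum>e\<in>UNIV. d\<Gamma> d e a k * ?h e b p)
      + (\<Sum>e\<in>UNIV. \<Sum>f\<in>UNIV. ?\<Gamma> p e a d * ?\<Gamma> p f e k * ?h f b p)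
      - (\<Sum>e\<in>UNIV. \<Sum>f\<in>UNIV. ?\<Gamma> p e a k * ?\<Gamma> p f e d * ?h f b p)"
  proof -
    have "(\<Sum>e\<in>UNIV. (\<Sum>f\<in>UNIV. ?\<Gamma> p e f i * ?\<Gamma> p f a j) * ?h e b p) =
        (\<Sum>e\<in>UNIV. \<Sum>f\<in>UNIV. ?\<Gamma> p e a j * ?\<Gamma> p f e i * ?h f b p)" for i j
      unfolding sum_distrib_right by (subst sum.swap) (simp add: mult_ac)
    then show ?thesis
      by (simp add: curv left_diff_distrib distrib_right sum.distrib sum_subtractf)
  qed
  have right: "(\<Sum>e\<in>UNIV. ?h a e p * curvature D c p e b k d) =
      (\<Sum>e\<in>UNIV. ?h a e p * d\<Gamma> k e b d) - (\<Sum>e\<in>UNIV. ?h a e p * d\<Gamma> d e b k)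
      + (\<Sum>e\<in>UNIV. \<Sum>f\<in>UNIV. ?h a f p * ?\<Gamma> p f e k * ?\<Gamma> p e b d)
      - (\<Sum>e\<in>UNIV. \<Sum>f\<in>UNIV. ?h a f p * ?\<Gamma> p f e d * ?\<Gamma> p e b k)"
  proof -
    have "(\<Sum>e\<in>UNIV. ?h a e p * (\<Sum>f\<in>UNIV. ?\<Gamma> p e f i * ?\<Gamma> p f b j)) =
        (\<Sum>e\<in>UNIV. \<Sum>f\<in>UNIV. ?h a f p * ?\<Gamma> p f e i * ?\<Gamma> p e b j)" for i j
      unfolding sum_distrib_left by (subst sum.swap) (simp add: mult_ac)
    then show ?thesis
      by (simp add: curv right_diff_distrib distrib_left sum.distrib sum_subtractf)
  qed
  \<comment> \<open>Exchanging the order of differentiation swaps the two cross terms, so they drop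
    out of the commutator.\<close>
  have cross: "(\<Sum>e\<in>UNIV. \<Sum>f\<in>UNIV. ?\<Gamma> p e a j * ?h e f p * ?\<Gamma> p f b i) =
      (\<Sum>e\<in>UNIV. \<Sum>f\<in>UNIV. ?\<Gamma> p f a j * ?h f e p * ?\<Gamma> p e b i)" for i j
    by (rule sum.swap)
  have "partial_deriv c k (partial_deriv c d (?h a b)) p = partial_deriv c d (partial_deriv c k (?h a b)) p"
    by (rule partial_deriv_commute[OF chart assms(3) smooth(2)])
  then show ?thesis
    unfolding left right second using cross[of d k] cross[of k d] by linarith
qed

section \<open>Contraction with the inverse metric\<close>

lemma inverse_metric_contraction:
  fixes B :: "real ^ 'n ^ 'n"
  assumes "invertible B" "transpose B = B"
  shows "(\<Sum>b\<in>UNIV. B $ e $ b * matrix_inv B $ b $ k) = kronecker e k"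
    "(\<Sum>b\<in>UNIV. matrix_inv B $ e $ b * B $ b $ k) = kronecker e k"
    "(\<Sum>b\<in>UNIV. B $ e $ b * matrix_inv B $ k $ b) = kronecker e k"
    "transpose (matrix_inv B) = matrix_inv B"
proof -
  show 1: "(\<Sum>b\<in>UNIV. B $ e $ b * matrix_inv B $ b $ k) = kronecker e k" for e k
    using arg_cong[OF matrix_inv_both(1)[OF assms(1)], of "\<lambda>C. C $ e $ k"]
    by (simp add: matrix_matrix_mult_def mat_def kronecker_def)
  show "(\<Sum>b\<in>UNIV. matrix_inv B $ e $ b * B $ b $ k) = kronecker e k"
    using arg_cong[OF matrix_inv_both(2)[OF assms(1)], of "\<lambda>C. C $ e $ k"]
    by (simp add: matrix_matrix_mult_def mat_def kronecker_def)
  have "transpose (matrix_inv B) ** B = mat 1"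
    using matrix_inv_both(1)[OF assms(1)] assms(2) by (metis matrix_transpose_mul transpose_mat)
  then show T: "transpose (matrix_inv B) = matrix_inv B"
    using matrix_inv_both(1)[OF assms(1)] by (metis matrix_mul_assoc matrix_mul_lid matrix_mul_rid)
  have "matrix_inv B $ k $ b = matrix_inv B $ b $ k" for b
    using arg_cong[OF T, of "\<lambda>C. C $ k $ b"] by (simp add: transpose_def)
  then show "(\<Sum>b\<in>UNIV. B $ e $ b * matrix_inv B $ k $ b) = kronecker e k"
    using 1 by simp
qed

lemma matrix_inv_matrix_inv:
  fixes B :: "real ^ 'n ^ 'n"
  assumes "invertible B"
  shows "invertible (matrix_inv B)" "matrix_inv (matrix_inv B) = B"
proof -
  show inv: "invertible (matrix_inv B)"
    using matrix_inv_both[OF assms] unfolding invertible_def by blast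
  show "matrix_inv (matrix_inv B) = B"
    using matrix_inv_both[OF assms] matrix_inv_both[OF inv]
    by (metis matrix_mul_assoc matrix_mul_lid matrix_mul_rid)
qed

lemma metric_invertible_symmetric:
  assumes "pseudo_riemannian_metric M \<A> h" "c \<in> \<A>" "p \<in> fst c"
  shows "invertible (h c p)" "transpose (h c p) = h c p"
  using assms unfolding pseudo_riemannian_metric_def by blast+

text \<open>The contracted Bianchi identity gives the skew part of Ricci as a trace of the curvature
  over its first two indices, and this trace vanishes because the lowered curvature is skew in
  them.\<close>

lemma ricci_levi_civita_sym:
  assumes "smooth_atlas M \<A>" "c \<in> \<A>" "p \<in> fst c"
    and "pseudo_riemannian_metric M \<A> h" "levi_civita_connection M \<A> h D"
  shows "ricci D c p a b = ricci D c p b a"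
proof -
  let ?h = "\<lambda>a b. h c p $ a $ b" and ?g = "\<lambda>a b. matrix_inv (h c p) $ a $ b"
    and ?R = "curvature D c p"
  note h = metric_invertible_symmetric[OF assms(4,2,3)]
  have tf: "torsion_free_connection M \<A> D"
    using assms(5) by (simp add: levi_civita_connection_def)
  have trace: "(\<Sum>e\<in>UNIV. ?R e e k d) = 0" for k d
  proof -
    \<comment> \<open>Both halves of the skewness identity contract to the same trace, so twice the
      trace is zero.\<close>
    have "0 = (\<Sum>b\<in>UNIV. \<Sum>a\<in>UNIV. ?g b a *
        ((\<Sum>e\<in>UNIV. ?R e a k d * ?h e b) + (\<Sum>e\<in>UNIV. ?h a e * ?R e b k d)))"
      by (simp add: curvature_metric_skew[OF assms])
    also have "\<dots> = (\<Sum>b\<in>UNIV. \<Sum>a\<in>UNIV. \<Sum>e\<in>UNIV. ?R e a k d * (?h e b * ?g b a))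
        + (\<Sum>b\<in>UNIV. \<Sum>a\<in>UNIV. \<Sum>e\<in>UNIV. (?g b a * ?h a e) * ?R e b k d)"
      by (simp add: distrib_left sum_distrib_left sum.distrib mult_ac)
    also have "(\<Sum>b\<in>UNIV. \<Sum>a\<in>UNIV. \<Sum>e\<in>UNIV. ?R e a k d * (?h e b * ?g b a)) =
        (\<Sum>a\<in>UNIV. \<Sum>e\<in>UNIV. \<Sum>b\<in>UNIV. ?R e a k d * (?h e b * ?g b a))"
      by (subst sum.swap, rule sum.cong[OF refl], rule sum.swap)
    also have "\<dots> = (\<Sum>a\<in>UNIV. ?R a a k d)"
      by (simp add: inverse_metric_contraction[OF h] flip: sum_distrib_left)
    also have "(\<Sum>b\<in>UNIV. \<Sum>a\<in>UNIV. \<Sum>e\<in>UNIV. (?g b a * ?h a e) * ?R e b k d) =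
        (\<Sum>b\<in>UNIV. \<Sum>e\<in>UNIV. \<Sum>a\<in>UNIV. (?g b a * ?h a e) * ?R e b k d)"
      by (rule sum.cong[OF refl], rule sum.swap)
    also have "\<dots> = (\<Sum>b\<in>UNIV. ?R b b k d)"
      by (simp add: inverse_metric_contraction[OF h] flip: sum_distrib_right)
    finally show ?thesis by simp
  qed
  have "(\<Sum>e\<in>UNIV. ?R e a e b + ?R e e b a + ?R e b a e) = 0"
    using first_bianchi[OF assms(1-3) tf] by simp
  then show ?thesis
    by (simp add: sum.distrib trace ricci_def curvature_skew[of D c p _ b _ a] sum_negf)
qed

lemma weyl_condition_levi_civita:
  assumes "smooth_atlas M \<A>" "pseudo_riemannian_metric M \<A> h" "levi_civita_connection M \<A> h D"
  shows "weyl_condition \<A> D (\<lambda>c p. matrix_inv (h c p))"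
  unfolding weyl_condition_def
proof (intro ballI allI)
  fix c p a d assume c: "c \<in> \<A>" "p \<in> fst c"
  let ?h = "\<lambda>a b. h c p $ a $ b" and ?g = "\<lambda>a b. matrix_inv (h c p) $ a $ b"
    and ?R = "curvature D c p" and ?P = "schouten D c p" and ?W = "projective_weyl D c p"
  note h = metric_invertible_symmetric[OF assms(2) c]
  note contract = inverse_metric_contraction[OF h]
  have hsym: "?h i j = ?h j i" for i j
    using arg_cong[OF h(2), of "\<lambda>C. C $ i $ j"] by (simp add: transpose_def)
  have Rsym: "ricci D c p i j = ricci D c p j i" for i j
    by (rule ricci_levi_civita_sym[OF assms(1) c assms(2,3)])
  have Psym: "?P i j = ?P j i" for i j
    by (simp add: schouten_def Rsym[of i j])
  \<comment> \<open>Symmetry of the Schouten tensor removes the term with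
    \<open>kronecker e b\<close>.\<close>
  have W: "?W e b k d = ?R e b k d - kronecker e k * ?P d b + kronecker e d * ?P k b" for e b k d
    by (simp add: projective_weyl_def Psym[of k d])
  have "(\<Sum>e\<in>UNIV. \<Sum>b\<in>UNIV. \<Sum>k\<in>UNIV. ?h a e * ?g b k * ?W e b k d) =
      - ricci D c p a d - ?P a d + ?h a d * (\<Sum>b\<in>UNIV. \<Sum>k\<in>UNIV. ?g b k * ?P k b)" for a d
  proof -
    have "(\<Sum>e\<in>UNIV. \<Sum>b\<in>UNIV. \<Sum>k\<in>UNIV. ?h a e * ?g b k * ?R e b k d) =
        (\<Sum>b\<in>UNIV. \<Sum>k\<in>UNIV. ?g b k * (\<Sum>e\<in>UNIV. ?h a e * ?R e b k d))"
      by (subst sum.swap, rule sum.cong[OF refl], subst sum.swap)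
        (simp add: sum_distrib_left mult_ac)
    \<comment> \<open>Skewness exchanges \<open>a\<close> and \<open>b\<close>. Now \<open>b\<close>
      sits on \<open>?h\<close>, where \<open>?g b k\<close> cancels it and identifies
      \<open>e\<close> with \<open>k\<close>, leaving the trace that defines Ricci.\<close>
    also have "\<dots> = (\<Sum>b\<in>UNIV. \<Sum>k\<in>UNIV. ?g b k * - (\<Sum>e\<in>UNIV. ?R e a k d * ?h e b))"
      using curvature_metric_skew[OF assms(1) c assms(2,3)] by (simp only: add_eq_0_iff2 minus_minus)
    also have "\<dots> = - (\<Sum>b\<in>UNIV. \<Sum>k\<in>UNIV. \<Sum>e\<in>UNIV. ?R e a k d * (?h e b * ?g b k))"
      by (simp add: sum_negf sum_distrib_left mult_ac)
    also have "(\<Sum>b\<in>UNIV. \<Sum>k\<in>UNIV. \<Sum>e\<in>UNIV. ?R e a k d * (?h e b * ?g b k)) =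
        (\<Sum>k\<in>UNIV. \<Sum>e\<in>UNIV. \<Sum>b\<in>UNIV. ?R e a k d * (?h e b * ?g b k))"
      by (subst sum.swap, rule sum.cong[OF refl], rule sum.swap)
    also have "\<dots> = ricci D c p a d"
      by (simp add: contract ricci_def flip: sum_distrib_left)
    finally have R: "(\<Sum>e\<in>UNIV. \<Sum>b\<in>UNIV. \<Sum>k\<in>UNIV. ?h a e * ?g b k * ?R e b k d) = - ricci D c p a d" .
    have "(\<Sum>e\<in>UNIV. \<Sum>b\<in>UNIV. \<Sum>k\<in>UNIV. ?h a e * ?g b k * (kronecker e k * ?P d b)) =
        (\<Sum>e\<in>UNIV. \<Sum>b\<in>UNIV. ?h a e * ?g b e * ?P d b)"
      by (simp add: mult.assoc mult.left_commute[of _ "kronecker _ _"])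
    also have "\<dots> = (\<Sum>b\<in>UNIV. (\<Sum>e\<in>UNIV. ?h a e * ?g b e) * ?P d b)"
      by (subst sum.swap) (simp add: sum_distrib_right)
    also have "\<dots> = ?P a d"
      by (simp add: contract Psym[of d a])
    finally have P1: "(\<Sum>e\<in>UNIV. \<Sum>b\<in>UNIV. \<Sum>k\<in>UNIV. ?h a e * ?g b k * (kronecker e k * ?P d b)) = ?P a d" .
    have "(\<Sum>e\<in>UNIV. \<Sum>b\<in>UNIV. \<Sum>k\<in>UNIV. ?h a e * ?g b k * (kronecker e d * ?P k b)) =
        (\<Sum>e\<in>UNIV. (?h a e * (\<Sum>b\<in>UNIV. \<Sum>k\<in>UNIV. ?g b k * ?P k b)) * kronecker e d)"
      by (simp add: sum_distrib_left sum_distrib_right mult_ac)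
    also have "\<dots> = ?h a d * (\<Sum>b\<in>UNIV. \<Sum>k\<in>UNIV. ?g b k * ?P k b)"
      by simp
    finally show ?thesis
      using R P1 by (simp add: W distrib_left right_diff_distrib sum.distrib sum_subtractf)
  qed
  then show "(\<Sum>e\<in>UNIV. \<Sum>b\<in>UNIV. \<Sum>k\<in>UNIV. matrix_inv (matrix_inv (h c p)) $ a $ e * ?g b k * ?W e b k d) =
      (\<Sum>e\<in>UNIV. \<Sum>b\<in>UNIV. \<Sum>k\<in>UNIV. matrix_inv (matrix_inv (h c p)) $ d $ e * ?g b k * ?W e b k a)"
    by (simp add: matrix_inv_matrix_inv[OF h(1)] Rsym[of a d] Psym[of a d] hsym[of a d])
qed

section \<open>The inverse metric as a smooth form with upper indices\<close>

lemma nondegenerate_upper_form_inverse_metric: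
  assumes "smooth_atlas M \<A>" "pseudo_riemannian_metric M \<A> h"
  shows "nondegenerate_upper_form M \<A> (\<lambda>c p. matrix_inv (h c p))"
proof -
  have sf: "smooth_family \<A> (topspace M) h"
    and tr: "\<And>c c' p. c \<in> \<A> \<Longrightarrow> c' \<in> \<A> \<Longrightarrow> p \<in> fst c \<inter> fst c' \<Longrightarrow>
       h c p = transpose (jac c c' p) ** h c' p ** jac c c' p"
    using assms(2) unfolding pseudo_riemannian_metric_def by blast+
  note h = metric_invertible_symmetric[OF assms(2)]
  have "smooth_family \<A> (topspace M) (\<lambda>c p. matrix_inv (h c p))"
    unfolding smooth_family_def smooth_on_def
  proof (intro ballI allI)
    fix c k assume c: "c \<in> \<A>"
    show "Ck_on k (snd c ` (topspace M \<inter> fst c)) (\<lambda>x. matrix_inv (h c (chart_inv c x)))"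
    proof (rule Ck_on_matrix_inv)
      show "open (snd c ` (topspace M \<inter> fst c))"
        by (rule open_chart_image[OF smooth_atlasD(1)[OF assms(1) c] openin_topspace])
      show "invertible (h c (chart_inv c x))" if "x \<in> snd c ` (topspace M \<inter> fst c)" for x
        using that h(1)[OF c] by (auto simp: chart_inv_snd[OF smooth_atlasD(1)[OF assms(1) c]])
      show "Ck_on k (snd c ` (topspace M \<inter> fst c)) (\<lambda>x. h c (chart_inv c x))"
        using sf c by (simp add: smooth_family_def smooth_on_def)
    qed
  qed
  moreover have "matrix_inv (h c' p) = jac c c' p ** matrix_inv (h c p) ** transpose (jac c c' p)"
    if c: "c \<in> \<A>" "c' \<in> \<A>" "p \<in> fst c \<inter> fst c'" for c c' p
  proof -
    let ?J = "jac c c' p"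
    have hc: "invertible (h c p)" and hc': "invertible (h c' p)"
      using h c by auto
    \<comment> \<open>The transformation law of \<open>h\<close> exhibits a left inverse of the
      Jacobian. For square matrices it is a right inverse too, which moves \<open>?J\<close> to the
      front and displays the claimed matrix as a left inverse of \<open>h c' p\<close>.\<close>
    have "(matrix_inv (h c p) ** (transpose ?J ** h c' p)) ** ?J = mat 1"
      using matrix_inv_both(2)[OF hc] tr[OF c] by (simp add: matrix_mul_assoc)
    then have "?J ** (matrix_inv (h c p) ** (transpose ?J ** h c' p)) = mat 1"
      using matrix_left_right_inverse by blast
    then have "(?J ** matrix_inv (h c p) ** transpose ?J) ** h c' p = mat 1"
      by (simp add: matrix_mul_assoc)
    then show ?thesis
      using matrix_inv_both(1)[OF hc'] by (metis matrix_mul_assoc matrix_mul_lid matrix_mul_rid)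
  qed
  ultimately show ?thesis
    using h matrix_inv_matrix_inv(1) inverse_metric_contraction(4)
    unfolding nondegenerate_upper_form_def by blast
qed

theorem theorem2p3:
  fixes M :: "'m topology"
    and \<A> :: "('m, 'n::finite) chart set"
    and \<P> :: "('m, 'n) connection set"
    and D :: "('m, 'n) connection"
  assumes "CARD('n) \<ge> 2"
    and "smooth_manifold M \<A>"
    and "projective_structure M \<A> \<P>"
    and "D \<in> \<P>"
  shows "((\<exists>D'\<in>\<P>. \<exists>h. pseudo_riemannian_metric M \<A> h \<and> levi_civita_connection M \<A> h D')
            \<longrightarrow> (\<exists>G. nondegenerate_upper_form M \<A> G \<and> weyl_condition \<A> D G))
       \<and> (\<forall>D'\<in>\<P>. \<forall>h. pseudo_riemannian_metric M \<A> h \<and> levi_civita_connection M \<A> h D'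
            \<longrightarrow> (\<exists>G \<phi>. nondegenerate_upper_form M \<A> G \<and> weyl_condition \<A> D G \<and>
                    smooth_function \<A> (topspace M) \<phi> \<and>
                    (\<forall>c\<in>\<A>. \<forall>p\<in>fst c. h c p = exp (2 * \<phi> p) *\<^sub>R matrix_inv (G c p))))"
proof -
  have atlas: "smooth_atlas M \<A>"
    using assms(2) by (simp add: smooth_manifold_def)
  \<comment> \<open>A member of the quotient is the set of connections related to some
    \<open>D0\<close>. The Weyl tensors of \<open>D\<close> and of a Levi-Civita connection in the
    class are compared through that of \<open>D0\<close>.\<close>
  obtain D0 where D0: "torsion_free_connection M \<A> D0"
    and equiv: "\<And>D'. D' \<in> \<P> \<Longrightarrow> projectively_equivalent M \<A> D0 D'"
    using assms(3) unfolding projective_structure_def by (auto elim!: quotientE)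
  have weyl: "projective_weyl D' c p a b k d = projective_weyl D c p a b k d"
    if "D' \<in> \<P>" "c \<in> \<A>" "p \<in> fst c" for D' c p a b k d
    using projective_weyl_invariant[OF assms(1) atlas that(2,3) D0 equiv] that(1) assms(4) by simp
  have G: "nondegenerate_upper_form M \<A> (\<lambda>c p. matrix_inv (h c p))"
      "weyl_condition \<A> D (\<lambda>c p. matrix_inv (h c p))"
      "\<forall>c\<in>\<A>. \<forall>p\<in>fst c. h c p = exp (2 * 0) *\<^sub>R matrix_inv (matrix_inv (h c p))"
    if "D' \<in> \<P>" and h: "pseudo_riemannian_metric M \<A> h" "levi_civita_connection M \<A> h D'" for D' h
  proof -
    show "nondegenerate_upper_form M \<A> (\<lambda>c p. matrix_inv (h c p))"
      by (rule nondegenerate_upper_form_inverse_metric[OF atlas h(1)])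
    \<comment> \<open>The condition involves the connection only through its Weyl tensor, so it
      passes from \<open>D'\<close> to the given representative \<open>D\<close>.\<close>
    show "weyl_condition \<A> D (\<lambda>c p. matrix_inv (h c p))"
      using weyl_condition_levi_civita[OF atlas h] by (simp add: weyl_condition_def weyl[OF \<open>D' \<in> \<P>\<close>])
    show "\<forall>c\<in>\<A>. \<forall>p\<in>fst c. h c p = exp (2 * 0) *\<^sub>R matrix_inv (matrix_inv (h c p))"
      using metric_invertible_symmetric(1)[OF h(1)] by (simp add: matrix_inv_matrix_inv(2))
  qed
  have zero: "smooth_function \<A> (topspace M) (\<lambda>_. 0)"
    by (simp add: smooth_function_def smooth_family_def smooth_on_def Ck_on_const)
  show ?thesis
  proof (intro conjI impI ballI allI)
    assume "\<exists>D'\<in>\<P>. \<exists>h. pseudo_riemannian_metric M \<A> h \<and> levi_civita_connection M \<A> h D'"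
    then show "\<exists>G. nondegenerate_upper_form M \<A> G \<and> weyl_condition \<A> D G"
      using G(1,2) by blast
  next
    fix D' h assume "D' \<in> \<P>" "pseudo_riemannian_metric M \<A> h \<and> levi_civita_connection M \<A> h D'"
    then show "\<exists>G \<phi>. nondegenerate_upper_form M \<A> G \<and> weyl_condition \<A> D G \<and>
        smooth_function \<A> (topspace M) \<phi> \<and>
        (\<forall>c\<in>\<A>. \<forall>p\<in>fst c. h c p = exp (2 * \<phi> p) *\<^sub>R matrix_inv (G c p))"
      using G[of D' h] zero
      by (intro exI[of _ "\<lambda>c p. matrix_inv (h c p)"] exI[of _ "\<lambda>_. 0"]) blast
  qed
qed

end
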